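(* Let $X$ and $Y$ be real Banach spaces, let $\kappa$ be an uncountable cardinal, and let $E\subseteq X$ and $F\subseteq Y$ be $\kappa$ ideals in $X$ and $Y$ respectively. Then $E\widehat{\otimes}_\pi F$ is a $\kappa$ ideal in $X\widehat{\otimes}_\pi Y$, and $E\widehat{\otimes}_\varepsilon F$ is a $\kappa$ ideal in $X\widehat{\otimes}_\varepsilon Y$.
   Context: For a normed space $Z$, $\operatorname{dens}(Z)$ is the least cardinality of a subset of $Z$ whose linear span is dense in $Z$. A subspace $Y$ of a Banach space $W$ is a $\kappa$ ideal in $W$ if for every subspace $G\subseteq W$ with $\operatorname{dens}(G)<\kappa$ there is a linear operator $P:G\to Y$ with $\|P\|\le 1$ and $P(e)=e$ for all $e\in G\cap Y$. $\widehat{\otimes}_\pi$ and $\widehat{\otimes}_\varepsilon$ denote the completed projective and injective tensor products of Banach spaces. The space $E\widehat{\otimes}_\pi F$ (resp. $E\widehat{\otimes}_\varepsilon F$) is regarded as a subspace of $X\widehat{\otimes}_\pi Y$ (resp. $X\widehat{\otimes}_\varepsilon Y$) through the canonical map induced by the inclusions $E\subseteq X$, $F\subseteq Y$. This map is isometric: always for the injective tensor product, and for the projective one because $E$ and $F$ are ideals in $X$ and $Y$ (a known result), where $E$ is an ideal in $X$ if for every finite dimensional $G\subseteq X$ and $\delta>0$ there is a linear $T:G\to E$ with $\|T\|\le 1+\delta$ and $T(e)=e$ for $e\in G\cap E$. *)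

theory Defs
  imports "HOL-Analysis.Analysis"
begin

unbundle cardinal_syntax

section \<open>Ideals of cardinal type\<close>

text \<open>The choice selects a subset of \<open>Z\<close> of least cardinality with dense linear span; \<open>dens_less_iff\<close>
  confirms that one exists.\<close>

definition dens :: "'w::real_normed_vector set \<Rightarrow> 'w rel"
  where "dens Z = |SOME A. A \<subseteq> Z \<and> Z \<subseteq> closure (span A) \<and>
    (\<forall>B. B \<subseteq> Z \<and> Z \<subseteq> closure (span B) \<longrightarrow> |A| \<le>o |B| )|"

lemma dens_less_iff:
  assumes "Card_order \<kappa>"
  shows "dens Z <o \<kappa> \<longleftrightarrow> (\<exists>A. A \<subseteq> Z \<and> Z \<subseteq> closure (span A) \<and> |A| <o \<kappa>)"
proof -
  let ?P = "\<lambda>A. A \<subseteq> Z \<and> Z \<subseteq> closure (span A)"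
  let ?Q = "\<lambda>A. A \<subseteq> Z \<and> Z \<subseteq> closure (span A) \<and>
    (\<forall>B. B \<subseteq> Z \<and> Z \<subseteq> closure (span B) \<longrightarrow> |A| \<le>o |B| )"
  have "Z \<subseteq> closure (span Z)"
    by (meson closure_subset span_superset subset_trans)
  then have "card_of ` Collect ?P \<noteq> {}" by blast
  moreover have "\<forall>r\<in>card_of ` Collect ?P. Card_order r" by (auto simp: card_of_Card_order)
  ultimately have "\<exists>r\<in>card_of ` Collect ?P. \<forall>r'\<in>card_of ` Collect ?P. r \<le>o r'"
    by (rule exists_minim_Card_order)
  then have "\<exists>A. ?Q A" by auto
  then have Q: "?Q (Eps ?Q)" by (rule someI_ex)
  show ?thesis
  proof
    assume "dens Z <o \<kappa>"
    with Q show "\<exists>A. A \<subseteq> Z \<and> Z \<subseteq> closure (span A) \<and> |A| <o \<kappa>"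
      unfolding dens_def by blast
  next
    assume "\<exists>A. A \<subseteq> Z \<and> Z \<subseteq> closure (span A) \<and> |A| <o \<kappa>"
    then obtain A where "A \<subseteq> Z" "Z \<subseteq> closure (span A)" "|A| <o \<kappa>" by blast
    with Q show "dens Z <o \<kappa>"
      unfolding dens_def by (meson ordLeq_ordLess_trans)
  qed
qed

definition linear_between :: "'w::real_vector set \<Rightarrow> 'v::real_vector set \<Rightarrow> ('w \<Rightarrow> 'v) \<Rightarrow> bool"
  where "linear_between G Y P \<longleftrightarrow> P ` G \<subseteq> Y \<and>
    (\<forall>x\<in>G. \<forall>y\<in>G. P (x + y) = P x + P y) \<and> (\<forall>c. \<forall>x\<in>G. P (c *\<^sub>R x) = c *\<^sub>R P x)"

text \<open>\<open>P\<close> is only constrained on \<open>G\<close>. Neither \<open>G\<close> nor \<open>Y\<close> is required to be closed.\<close>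

definition kappa_ideal :: "'k rel \<Rightarrow> 'w::banach set \<Rightarrow> bool"
  where "kappa_ideal \<kappa> Y \<longleftrightarrow> subspace Y \<and>
    (\<forall>G. subspace G \<and> dens G <o \<kappa> \<longrightarrow>
      (\<exists>P. linear_between G Y P \<and> (\<forall>x\<in>G. norm (P x) \<le> norm x) \<and> (\<forall>e\<in>G \<inter> Y. P e = e)))"


section \<open>The algebraic tensor product\<close>

text \<open>A list \<open>[(x\<^sub>1, y\<^sub>1), \<dots>, (x\<^sub>n, y\<^sub>n)]\<close> stands for \<open>x\<^sub>1 \<otimes> y\<^sub>1 + \<dots> + x\<^sub>n \<otimes> y\<^sub>n\<close>. Two such sums are
  the same tensor iff every bilinear form takes the same value on them, i.e. \<open>x \<otimes> y\<close> is the evaluation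
  functional \<open>B \<mapsto> B(x, y)\<close> on the space of bilinear forms.\<close>

definition form_sum :: "('a \<Rightarrow> 'b \<Rightarrow> real) \<Rightarrow> ('a \<times> 'b) list \<Rightarrow> real"
  where "form_sum B ps = (\<Sum>(x, y)\<leftarrow>ps. B x y)"

definition same_tensor ::
  "('a::real_vector \<times> 'b::real_vector) list \<Rightarrow> ('a \<times> 'b) list \<Rightarrow> bool"
  where "same_tensor ps qs \<longleftrightarrow> (\<forall>B. bilinear B \<longrightarrow> form_sum B ps = form_sum B qs)"

lemma form_sum_simps [simp]:
  "form_sum B [] = 0"
  "form_sum B (p # ps) = B (fst p) (snd p) + form_sum B ps"
  "form_sum B (ps @ qs) = form_sum B ps + form_sum B qs"
  by (auto simp: form_sum_def case_prod_unfold)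

lemma form_sum_scale:
  assumes "bilinear B"
  shows "form_sum B (map (\<lambda>(x, y). (c *\<^sub>R x, y)) ps) = c * form_sum B ps"
  using assms by (induction ps) (auto simp: bilinear_lmul algebra_simps)

lemma form_sum_minus:
  assumes "bilinear B"
  shows "form_sum B (map (\<lambda>(x, y). (- x, y)) ps) = - form_sum B ps"
  using form_sum_scale[OF assms, of "-1" ps] by simp

quotient_type (overloaded) ('a, 'b) tensor =
  "('a::real_vector \<times> 'b::real_vector) list" / same_tensor
  by (rule equivpI) (auto simp: reflp_def symp_def transp_def same_tensor_def)

instantiation tensor :: (real_vector, real_vector) real_vector
begin

lift_definition zero_tensor :: "('a, 'b) tensor" is "[]" .

lift_definition plus_tensor :: "('a, 'b) tensor \<Rightarrow> ('a, 'b) tensor \<Rightarrow> ('a, 'b) tensor" is append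
  by (simp add: same_tensor_def)

lift_definition scaleR_tensor :: "real \<Rightarrow> ('a, 'b) tensor \<Rightarrow> ('a, 'b) tensor"
  is "\<lambda>c. map (\<lambda>(x, y). (c *\<^sub>R x, y))"
  by (simp add: same_tensor_def form_sum_scale)

definition uminus_tensor :: "('a, 'b) tensor \<Rightarrow> ('a, 'b) tensor"
  where "uminus_tensor u = (-1) *\<^sub>R u"

definition minus_tensor :: "('a, 'b) tensor \<Rightarrow> ('a, 'b) tensor \<Rightarrow> ('a, 'b) tensor"
  where "minus_tensor u v = u + (- v)"

instance
proof
  fix u v w :: "('a, 'b) tensor" and a b :: real
  show "u + v + w = u + (v + w)" by transfer (simp add: same_tensor_def)
  show "u + v = v + u" by transfer (simp add: same_tensor_def)
  show "0 + u = u" by transfer (simp add: same_tensor_def)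
  show "- u + u = 0" unfolding uminus_tensor_def
    by transfer (simp add: same_tensor_def form_sum_minus)
  show "u - v = u + - v" by (simp add: minus_tensor_def)
  show "a *\<^sub>R (u + v) = a *\<^sub>R u + a *\<^sub>R v"
    by transfer (simp add: same_tensor_def form_sum_scale algebra_simps)
  show "(a + b) *\<^sub>R u = a *\<^sub>R u + b *\<^sub>R u"
    by transfer (simp add: same_tensor_def form_sum_scale distrib_right)
  show "a *\<^sub>R b *\<^sub>R u = (a * b) *\<^sub>R u"
    by transfer (auto simp: same_tensor_def form_sum_scale simp del: map_map list.map_comp)
  show "1 *\<^sub>R u = u" by transfer (simp add: same_tensor_def form_sum_scale)
qed

end

lift_definition elem_tensor :: "'a::real_vector \<Rightarrow> 'b::real_vector \<Rightarrow> ('a, 'b) tensor"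
  is "\<lambda>x y. [(x, y)]" .

definition tensor_sum :: "('a::real_vector \<times> 'b::real_vector) list \<Rightarrow> ('a, 'b) tensor"
  where "tensor_sum ps = (\<Sum>(x, y)\<leftarrow>ps. elem_tensor x y)"

text \<open>For subspaces, this is the algebraic tensor product of \<open>E\<close> and \<open>F\<close>.\<close>

definition alg_tensor :: "'a::real_vector set \<Rightarrow> 'b::real_vector set \<Rightarrow> ('a, 'b) tensor set"
  where "alg_tensor E F = span {elem_tensor x y |x y. x \<in> E \<and> y \<in> F}"

lemma tensor_sum_simps [simp]:
  "tensor_sum [] = 0"
  "tensor_sum (p # ps) = elem_tensor (fst p) (snd p) + tensor_sum ps"
  "tensor_sum (ps @ qs) = tensor_sum ps + tensor_sum qs"
  by (auto simp: tensor_sum_def case_prod_unfold)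

lemma tensor_sum_abs: "tensor_sum ps = abs_tensor ps"
proof (induction ps)
  case Nil
  show ?case by (simp add: zero_tensor.abs_eq)
next
  case (Cons p ps)
  then show ?case by (simp add: elem_tensor.abs_eq plus_tensor.abs_eq)
qed

lemma tensor_sum_exhaust: obtains ps where "u = tensor_sum ps"
  by (metis tensor_sum_abs Quotient3_abs_rep Quotient3_tensor)

lemma tensor_sum_eq_iff: "tensor_sum ps = tensor_sum qs \<longleftrightarrow> same_tensor ps qs"
  by (simp add: tensor_sum_abs tensor.abs_eq_iff)

lemma tensor_sum_scale: "c *\<^sub>R tensor_sum ps = tensor_sum (map (\<lambda>(x, y). (c *\<^sub>R x, y)) ps)"
  by (simp add: tensor_sum_abs scaleR_tensor.abs_eq)


lemma form_sum_eq_if_tensor_sum_eq: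
  assumes "tensor_sum ps = tensor_sum qs" "bilinear B"
  shows "form_sum B ps = form_sum B qs"
  using assms by (simp add: tensor_sum_eq_iff same_tensor_def)


lifting_forget tensor.lifting


section \<open>The projective and the injective norm\<close>

text \<open>The closed unit ball of the dual of a subspace \<open>E\<close>; values outside \<open>E\<close> are irrelevant.\<close>

definition dual_ball :: "'a::real_normed_vector set \<Rightarrow> ('a \<Rightarrow> real) set"
  where "dual_ball E = {\<phi>. linear_between E UNIV \<phi> \<and> (\<forall>x\<in>E. \<bar>\<phi> x\<bar> \<le> norm x)}"

text \<open>For subspaces \<open>E\<close>, \<open>F\<close>, these are the norms intrinsic to \<open>E \<otimes> F\<close>: the projective norm uses only
  representations with entries in \<open>E\<close> and \<open>F\<close>, and the injective norm only functionals on \<open>E\<close> and \<open>F\<close>.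
  They are meaningful on \<open>alg_tensor E F\<close>. The sum in \<open>inj_norm\<close> does not depend on the
  representation \<open>ps\<close> (\<open>dual_pair_well_defined\<close> below).\<close>

definition proj_norm ::
  "'a::real_normed_vector set \<Rightarrow> 'b::real_normed_vector set \<Rightarrow> ('a, 'b) tensor \<Rightarrow> real"
  where "proj_norm E F u =
    Inf {(\<Sum>(x, y)\<leftarrow>ps. norm x * norm y) |ps. set ps \<subseteq> E \<times> F \<and> tensor_sum ps = u}"

definition inj_norm ::
  "'a::real_normed_vector set \<Rightarrow> 'b::real_normed_vector set \<Rightarrow> ('a, 'b) tensor \<Rightarrow> real"
  where "inj_norm E F u =
    Sup {\<bar>\<Sum>(x, y)\<leftarrow>ps. \<phi> x * \<psi> y\<bar> |\<phi> \<psi> ps.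
      \<phi> \<in> dual_ball E \<and> \<psi> \<in> dual_ball F \<and> set ps \<subseteq> E \<times> F \<and> tensor_sum ps = u}"

lemma linear_between_extend:
  fixes \<phi> :: "'a::real_vector \<Rightarrow> real"
  assumes E: "subspace E" and \<phi>: "linear_between E UNIV \<phi>"
  obtains g where "linear g" "\<And>x. x \<in> E \<Longrightarrow> g x = \<phi> x"
proof -
  obtain B where B: "B \<subseteq> E" "independent B" "E \<subseteq> span B" "span B = E"
    by (metis E basis_exists span_subspace)
  obtain g where g: "linear g" "\<forall>x\<in>B. g x = \<phi> x"
    using linear_independent_extend[OF B(2), of \<phi>] by blast
  interpret g: linear g by (rule g(1))
  have "\<phi> (0 *\<^sub>R 0) = 0 *\<^sub>R \<phi> 0"
    using \<phi> subspace_0[OF E] unfolding linear_between_def by blast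
  then have zero: "\<phi> 0 = 0" by simp
  have "x \<in> E \<and> g x = \<phi> x" if "x \<in> span B" for x
    using that
  proof (induction rule: span_induct_alt)
    case base
    then show ?case using E zero by (simp add: subspace_0 g.zero)
  next
    case (step c x y)
    then have "x \<in> E" "c *\<^sub>R x \<in> E" using B E by (auto intro: subspace_scale)
    with step g \<phi> E show ?case
      by (simp add: linear_between_def g.add g.scale subspace_add)
  qed
  with g(1) B(4) that show thesis by blast
qed

lemma bilinear_mult_linear:
  fixes g :: "'a::real_vector \<Rightarrow> real" and h :: "'b::real_vector \<Rightarrow> real"
  assumes "linear g" "linear h"
  shows "bilinear (\<lambda>x y. g x * h y)"
  using assms
  by (auto simp: bilinear_def linear_iff algebra_simps)

lemma dual_pair_well_defined:
  assumes "subspace E" "subspace F" "\<phi> \<in> dual_ball E" "\<psi> \<in> dual_ball F"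
    and "set ps \<subseteq> E \<times> F" "set qs \<subseteq> E \<times> F" "tensor_sum ps = tensor_sum qs"
  shows "(\<Sum>(x, y)\<leftarrow>ps. \<phi> x * \<psi> y) = (\<Sum>(x, y)\<leftarrow>qs. \<phi> x * \<psi> y)"
proof -
  obtain g where g: "linear g" "\<And>x. x \<in> E \<Longrightarrow> g x = \<phi> x"
    using assms linear_between_extend unfolding dual_ball_def by blast
  obtain h where h: "linear h" "\<And>x. x \<in> F \<Longrightarrow> h x = \<psi> x"
    using assms linear_between_extend unfolding dual_ball_def by blast
  have eq: "(\<Sum>(x, y)\<leftarrow>rs. \<phi> x * \<psi> y) = form_sum (\<lambda>x y. g x * h y) rs" if "set rs \<subseteq> E \<times> F" for rs
    using that by (induction rs) (auto simp: g h)
  show ?thesis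
    using form_sum_eq_if_tensor_sum_eq[OF assms(7) bilinear_mult_linear[OF g(1) h(1)]]
    by (simp add: eq assms)
qed

locale seminorm =
  fixes p :: "'s::real_vector \<Rightarrow> real"
  assumes add_le: "p (u + v) \<le> p u + p v"
    and scaleR_eq: "p (c *\<^sub>R u) = \<bar>c\<bar> * p u"
begin

lemma zero [simp]: "p 0 = 0"
  using scaleR_eq[of 0 0] by simp

lemma minus [simp]: "p (- u) = p u"
  using scaleR_eq[of "-1" u] by simp

lemma diff_commute: "p (u - v) = p (v - u)"
  using minus[of "u - v"] by simp

lemma nonneg: "0 \<le> p u"
  using add_le[of u "- u"] by simp

lemma diff_triangle: "p (u - w) \<le> p (u - v) + p (v - w)"
  using add_le[of "u - v" "v - w"] by simp

lemma abs_diff_le: "\<bar>p u - p v\<bar> \<le> p (u - v)"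
  using add_le[of "u - v" v] add_le[of "v - u" u] diff_commute[of u v] by auto

end

lemma seminormI:
  fixes p :: "'s::real_vector \<Rightarrow> real"
  assumes "\<And>u v. p (u + v) \<le> p u + p v" "\<And>c u. p (c *\<^sub>R u) \<le> \<bar>c\<bar> * p u" "p 0 = 0"
  shows "seminorm p"
proof
  fix u :: 's and c :: real
  show "p (c *\<^sub>R u) = \<bar>c\<bar> * p u"
  proof (cases "c = 0")
    case False
    have "p u \<le> \<bar>inverse c\<bar> * p (c *\<^sub>R u)"
      using assms(2)[of "inverse c" "c *\<^sub>R u"] False by simp
    then have "\<bar>c\<bar> * p u \<le> p (c *\<^sub>R u)"
      using False by (simp add: field_simps)
    with assms(2)[of c u] show ?thesis by simp
  qed (use assms in auto)
qed (rule assms)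

lemma norm_sum_nonneg: "0 \<le> (\<Sum>(x, y)\<leftarrow>ps. norm x * norm y)"
  by (induction ps) auto

lemma proj_norm_le: "proj_norm UNIV UNIV (tensor_sum ps) \<le> (\<Sum>(x, y)\<leftarrow>ps. norm x * norm y)"
  unfolding proj_norm_def
  by (rule cInf_lower) (auto intro!: bdd_belowI[of _ 0] norm_sum_nonneg)

lemma proj_norm_greatest:
  assumes "\<And>ps. tensor_sum ps = u \<Longrightarrow> c \<le> (\<Sum>(x, y)\<leftarrow>ps. norm x * norm y)"
  shows "c \<le> proj_norm UNIV UNIV u"
  unfolding proj_norm_def
proof (rule cInf_greatest)
  obtain ps where "u = tensor_sum ps" by (rule tensor_sum_exhaust)
  then show "{(\<Sum>(x, y)\<leftarrow>ps. norm x * norm y) |ps. set ps \<subseteq> UNIV \<times> UNIV \<and> tensor_sum ps = u} \<noteq> {}"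
    by auto
qed (use assms in auto)

interpretation proj_norm: seminorm
  "proj_norm (UNIV :: 'a::real_normed_vector set) (UNIV :: 'b::real_normed_vector set)"
proof (rule seminormI)
  let ?p = "proj_norm (UNIV :: 'a set) (UNIV :: 'b set)"
  let ?c = "\<lambda>ps :: ('a \<times> 'b) list. \<Sum>(x, y)\<leftarrow>ps. norm x * norm y"
  fix u v :: "('a, 'b) tensor" and c :: real
  have *: "?p (tensor_sum ps + tensor_sum qs) \<le> ?c ps + ?c qs" for ps qs
    using proj_norm_le[of "ps @ qs"] by simp
  have "?p (u + v) - ?c ps \<le> ?p v" if "tensor_sum ps = u" for ps
  proof (rule proj_norm_greatest)
    fix qs :: "('a \<times> 'b) list"
    assume "tensor_sum qs = v"
    with *[of ps qs] that show "?p (u + v) - ?c ps \<le> ?c qs" by simp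
  qed
  note le_v = this
  have "?p (u + v) - ?p v \<le> ?p u"
  proof (rule proj_norm_greatest)
    fix ps :: "('a \<times> 'b) list"
    assume "tensor_sum ps = u"
    from le_v[OF this] show "?p (u + v) - ?p v \<le> ?c ps" by simp
  qed
  then show "?p (u + v) \<le> ?p u + ?p v" by simp
  have scale: "?c (map (\<lambda>(x, y). (c *\<^sub>R x, y)) ps) = \<bar>c\<bar> * ?c ps" for ps
    by (induction ps) (auto simp: algebra_simps)
  have le: "?p (c *\<^sub>R u) \<le> \<bar>c\<bar> * ?c ps" if "tensor_sum ps = u" for ps
    using proj_norm_le[of "map (\<lambda>(x, y). (c *\<^sub>R x, y)) ps"] that scale
    by (metis tensor_sum_scale)
  have ge0: "0 \<le> ?p w" for w by (rule proj_norm_greatest) (rule norm_sum_nonneg)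
  show zero: "?p 0 = 0" using proj_norm_le[of "[] :: ('a \<times> 'b) list"] ge0[of 0] by simp
  show "?p (c *\<^sub>R u) \<le> \<bar>c\<bar> * ?p u"
  proof (cases "c = 0")
    case False
    have "?p (c *\<^sub>R u) / \<bar>c\<bar> \<le> ?p u"
      by (rule proj_norm_greatest) (use le False in \<open>simp add: field_simps\<close>)
    then show ?thesis using False by (simp add: field_simps)
  qed (use zero in simp)
qed

lemma zero_in_dual_ball [simp]: "(\<lambda>_. 0) \<in> dual_ball E"
  by (simp add: dual_ball_def linear_between_def)

lemma dual_pair_bound:
  assumes "\<phi> \<in> dual_ball UNIV" "\<psi> \<in> dual_ball UNIV"
  shows "\<bar>\<Sum>(x, y)\<leftarrow>ps. \<phi> x * \<psi> y\<bar> \<le> (\<Sum>(x, y)\<leftarrow>ps. norm x * norm y)"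
proof (induction ps)
  case (Cons p ps)
  have "\<bar>\<phi> (fst p) * \<psi> (snd p)\<bar> \<le> norm (fst p) * norm (snd p)"
    using assms by (auto simp: dual_ball_def abs_mult intro!: mult_mono)
  with Cons show ?case by (auto simp: case_prod_unfold)
qed simp

lemma inj_norm_ge:
  assumes "\<phi> \<in> dual_ball UNIV" "\<psi> \<in> dual_ball UNIV"
  shows "\<bar>\<Sum>(x, y)\<leftarrow>ps. \<phi> x * \<psi> y\<bar> \<le> inj_norm UNIV UNIV (tensor_sum ps)"
  unfolding inj_norm_def
proof (rule cSup_upper)
  show "bdd_above {\<bar>\<Sum>(x, y)\<leftarrow>qs. \<phi> x * \<psi> y\<bar> |\<phi> \<psi> qs. \<phi> \<in> dual_ball UNIV \<and>
      \<psi> \<in> dual_ball UNIV \<and> set qs \<subseteq> UNIV \<times> UNIV \<and> tensor_sum qs = tensor_sum ps}"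
  proof (rule bdd_aboveI, safe)
    fix \<phi> :: "'a \<Rightarrow> real" and \<psi> :: "'b \<Rightarrow> real" and qs
    assume *: "\<phi> \<in> dual_ball UNIV" "\<psi> \<in> dual_ball UNIV" "tensor_sum qs = tensor_sum ps"
    show "\<bar>\<Sum>(x, y)\<leftarrow>qs. \<phi> x * \<psi> y\<bar> \<le> (\<Sum>(x, y)\<leftarrow>ps. norm x * norm y)"
      using dual_pair_well_defined[of UNIV UNIV \<phi> \<psi> qs ps] dual_pair_bound[of \<phi> \<psi> ps] * by simp
  qed
qed (use assms in auto)

lemma inj_norm_least:
  fixes ps :: "('a::real_normed_vector \<times> 'b::real_normed_vector) list"
  assumes "\<And>\<phi> \<psi>. \<phi> \<in> dual_ball UNIV \<Longrightarrow> \<psi> \<in> dual_ball UNIV \<Longrightarrow> \<bar>\<Sum>(x, y)\<leftarrow>ps. \<phi> x * \<psi> y\<bar> \<le> c"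
  shows "inj_norm UNIV UNIV (tensor_sum ps) \<le> c"
  unfolding inj_norm_def
proof (rule cSup_least)
  have "\<bar>\<Sum>(x, y)\<leftarrow>ps. (\<lambda>_::'a. 0::real) x * (\<lambda>_::'b. 0::real) y\<bar> \<in>
    {\<bar>\<Sum>(x, y)\<leftarrow>qs. \<phi> x * \<psi> y\<bar> |\<phi> \<psi> qs. \<phi> \<in> dual_ball UNIV \<and>
      \<psi> \<in> dual_ball UNIV \<and> set qs \<subseteq> UNIV \<times> UNIV \<and> tensor_sum qs = tensor_sum ps}"
    unfolding mem_Collect_eq by (intro exI conjI) (rule refl, auto)
  then show "{\<bar>\<Sum>(x, y)\<leftarrow>qs. \<phi> x * \<psi> y\<bar> |\<phi> \<psi> qs. \<phi> \<in> dual_ball UNIV \<and>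
      \<psi> \<in> dual_ball UNIV \<and> set qs \<subseteq> UNIV \<times> UNIV \<and> tensor_sum qs = tensor_sum ps} \<noteq> {}"
    by blast
next
  fix t
  assume "t \<in> {\<bar>\<Sum>(x, y)\<leftarrow>qs. \<phi> x * \<psi> y\<bar> |\<phi> \<psi> qs. \<phi> \<in> dual_ball UNIV \<and>
      \<psi> \<in> dual_ball UNIV \<and> set qs \<subseteq> UNIV \<times> UNIV \<and> tensor_sum qs = tensor_sum ps}"
  then obtain \<phi> \<psi> qs where *: "t = \<bar>\<Sum>(x, y)\<leftarrow>qs. \<phi> x * \<psi> y\<bar>" "\<phi> \<in> dual_ball UNIV"
      "\<psi> \<in> dual_ball UNIV" "tensor_sum qs = tensor_sum ps" by auto
  then show "t \<le> c"
    using dual_pair_well_defined[of UNIV UNIV \<phi> \<psi> qs ps] assms[of \<phi> \<psi>] by simp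
qed

interpretation inj_norm: seminorm
  "inj_norm (UNIV :: 'a::real_normed_vector set) (UNIV :: 'b::real_normed_vector set)"
proof (rule seminormI)
  let ?p = "inj_norm (UNIV :: 'a set) (UNIV :: 'b set)"
  fix u v :: "('a, 'b) tensor" and c :: real
  obtain ps qs where u: "u = tensor_sum ps" and v: "v = tensor_sum qs"
    by (metis tensor_sum_exhaust)
  have "?p (tensor_sum (ps @ qs)) \<le> ?p u + ?p v"
  proof (rule inj_norm_least)
    fix \<phi> :: "'a \<Rightarrow> real" and \<psi> :: "'b \<Rightarrow> real"
    assume "\<phi> \<in> dual_ball UNIV" "\<psi> \<in> dual_ball UNIV"
    from inj_norm_ge[OF this, of ps] inj_norm_ge[OF this, of qs]
    show "\<bar>\<Sum>(x, y)\<leftarrow>ps @ qs. \<phi> x * \<psi> y\<bar> \<le> ?p u + ?p v" by (simp add: u v)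
  qed
  then show "?p (u + v) \<le> ?p u + ?p v" by (simp add: u v)
  have "?p (tensor_sum (map (\<lambda>(x, y). (c *\<^sub>R x, y)) ps)) \<le> \<bar>c\<bar> * ?p u"
  proof (rule inj_norm_least)
    fix \<phi> :: "'a \<Rightarrow> real" and \<psi> :: "'b \<Rightarrow> real"
    assume *: "\<phi> \<in> dual_ball UNIV" "\<psi> \<in> dual_ball UNIV"
    then have hom: "\<phi> (c *\<^sub>R x) = c * \<phi> x" for x by (simp add: dual_ball_def linear_between_def)
    have "(\<Sum>(x, y)\<leftarrow>map (\<lambda>(x, y). (c *\<^sub>R x, y)) ps. \<phi> x * \<psi> y) = c * (\<Sum>(x, y)\<leftarrow>ps. \<phi> x * \<psi> y)"
      by (induction ps) (auto simp: hom algebra_simps)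
    with inj_norm_ge[OF *, of ps]
    show "\<bar>\<Sum>(x, y)\<leftarrow>map (\<lambda>(x, y). (c *\<^sub>R x, y)) ps. \<phi> x * \<psi> y\<bar> \<le> \<bar>c\<bar> * ?p u"
      by (simp add: u abs_mult mult_left_mono)
  qed
  then show "?p (c *\<^sub>R u) \<le> \<bar>c\<bar> * ?p u" by (simp add: u tensor_sum_scale)
  have "?p (tensor_sum []) \<le> 0" by (rule inj_norm_least) simp
  moreover have "0 \<le> ?p (tensor_sum [])"
    using inj_norm_ge[OF zero_in_dual_ball zero_in_dual_ball, of "[]"] by simp
  ultimately show "?p 0 = 0" by simp
qed


section \<open>Completion\<close>

text \<open>The completion of a space with a (semi)norm \<open>p\<close>, as \<open>p\<close>-Cauchy sequences modulo \<open>p\<close>-null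
  sequences. Both tensor norms are norms, but this construction does not need their definiteness.\<close>

definition cauchy_wrt :: "('s::real_vector \<Rightarrow> real) \<Rightarrow> (nat \<Rightarrow> 's) \<Rightarrow> bool"
  where "cauchy_wrt p u \<longleftrightarrow> (\<forall>e>0. \<exists>N. \<forall>m\<ge>N. \<forall>n\<ge>N. p (u m - u n) < e)"

definition completion_rel :: "('s::real_vector \<Rightarrow> real) \<Rightarrow> (nat \<Rightarrow> 's) \<Rightarrow> (nat \<Rightarrow> 's) \<Rightarrow> bool"
  where "completion_rel p u v \<longleftrightarrow>
    cauchy_wrt p u \<and> cauchy_wrt p v \<and> (\<lambda>n. p (u n - v n)) \<longlonglongrightarrow> 0"

context seminorm
begin

lemma completion_rel_refl: "completion_rel p u u \<longleftrightarrow> cauchy_wrt p u"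
  by (simp add: completion_rel_def)

lemma cauchy_const: "cauchy_wrt p (\<lambda>_. u)"
  by (simp add: cauchy_wrt_def)

lemma completion_rel_const: "completion_rel p (\<lambda>_. u) (\<lambda>_. u)"
  by (simp add: completion_rel_refl cauchy_const)

lemma null_le:
  assumes "f \<longlonglongrightarrow> 0" "\<And>n. p (u n) \<le> f n"
  shows "(\<lambda>n. p (u n)) \<longlonglongrightarrow> 0"
  by (rule tendsto_sandwich[OF _ _ tendsto_const assms(1)]) (auto simp: assms nonneg)

lemma part_equivp_completion_rel: "part_equivp (completion_rel p)"
proof (rule part_equivpI)
  show "\<exists>u. completion_rel p u u" using completion_rel_const by blast
  show "symp (completion_rel p)"
    by (rule sympI) (simp add: completion_rel_def diff_commute)
  show "transp (completion_rel p)"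
  proof (rule transpI)
    fix u v w
    assume *: "completion_rel p u v" "completion_rel p v w"
    then have "(\<lambda>n. p (u n - v n) + p (v n - w n)) \<longlonglongrightarrow> 0"
      using tendsto_add[of "\<lambda>n. p (u n - v n)" 0 _ "\<lambda>n. p (v n - w n)" 0]
      by (simp add: completion_rel_def)
    from null_le[OF this diff_triangle] * show "completion_rel p u w"
      by (simp add: completion_rel_def)
  qed
qed

lemma cauchy_add:
  assumes "cauchy_wrt p u" "cauchy_wrt p v"
  shows "cauchy_wrt p (\<lambda>n. u n + v n)"
  unfolding cauchy_wrt_def
proof (intro allI impI)
  fix e :: real
  assume "0 < e"
  then obtain M N where MN: "\<And>m n. m \<ge> M \<Longrightarrow> n \<ge> M \<Longrightarrow> p (u m - u n) < e / 2"
      "\<And>m n. m \<ge> N \<Longrightarrow> n \<ge> N \<Longrightarrow> p (v m - v n) < e / 2"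
    using assms unfolding cauchy_wrt_def by (meson half_gt_zero)
  have "p (u m + v m - (u n + v n)) < e" if "m \<ge> max M N" "n \<ge> max M N" for m n
    using MN(1)[of m n] MN(2)[of m n] add_le[of "u m - u n" "v m - v n"] that
    by (simp add: algebra_simps)
  then show "\<exists>N. \<forall>m\<ge>N. \<forall>n\<ge>N. p (u m + v m - (u n + v n)) < e" by blast
qed

lemma cauchy_scaleR:
  assumes "cauchy_wrt p u"
  shows "cauchy_wrt p (\<lambda>n. c *\<^sub>R u n)"
  unfolding cauchy_wrt_def
proof (intro allI impI)
  fix e :: real
  assume "0 < e"
  then have "0 < e / (\<bar>c\<bar> + 1)" by (simp add: add_nonneg_pos)
  then obtain N where N: "\<And>m n. m \<ge> N \<Longrightarrow> n \<ge> N \<Longrightarrow> p (u m - u n) < e / (\<bar>c\<bar> + 1)"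
    using assms unfolding cauchy_wrt_def by meson
  have "p (c *\<^sub>R u m - c *\<^sub>R u n) < e" if "m \<ge> N" "n \<ge> N" for m n
  proof -
    have "p (c *\<^sub>R u m - c *\<^sub>R u n) = \<bar>c\<bar> * p (u m - u n)"
      by (simp add: scaleR_eq flip: scaleR_right_diff_distrib)
    also have "\<dots> \<le> (\<bar>c\<bar> + 1) * p (u m - u n)"
      by (intro mult_right_mono nonneg) simp
    also have "\<dots> < e" using N[OF that] by (simp add: field_simps add_nonneg_pos)
    finally show ?thesis .
  qed
  then show "\<exists>N. \<forall>m\<ge>N. \<forall>n\<ge>N. p (c *\<^sub>R u m - c *\<^sub>R u n) < e" by blast
qed

lemma completion_rel_add:
  assumes "completion_rel p u u'" "completion_rel p v v'"
  shows "completion_rel p (\<lambda>n. u n + v n) (\<lambda>n. u' n + v' n)"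
proof -
  have "(\<lambda>n. p (u n - u' n) + p (v n - v' n)) \<longlonglongrightarrow> 0"
    using assms tendsto_add[of "\<lambda>n. p (u n - u' n)" 0 _ "\<lambda>n. p (v n - v' n)" 0]
    by (simp add: completion_rel_def)
  then have "(\<lambda>n. p (u n + v n - (u' n + v' n))) \<longlonglongrightarrow> 0"
  proof (rule null_le)
    show "p (u n + v n - (u' n + v' n)) \<le> p (u n - u' n) + p (v n - v' n)" for n
      using add_le[of "u n - u' n" "v n - v' n"] by (simp add: algebra_simps)
  qed
  with assms show ?thesis by (simp add: completion_rel_def cauchy_add)
qed

lemma completion_rel_scaleR:
  assumes "completion_rel p u u'"
  shows "completion_rel p (\<lambda>n. c *\<^sub>R u n) (\<lambda>n. c *\<^sub>R u' n)"
proof -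
  have "(\<lambda>n. p (c *\<^sub>R u n - c *\<^sub>R u' n)) \<longlonglongrightarrow> 0"
    using assms tendsto_mult_right_zero[of "\<lambda>n. p (u n - u' n)" _ "\<bar>c\<bar>"]
    by (simp add: completion_rel_def scaleR_eq flip: scaleR_right_diff_distrib)
  with assms show ?thesis by (simp add: completion_rel_def cauchy_scaleR)
qed

lemma cauchy_tendsto_lim:
  assumes "cauchy_wrt p u"
  shows "(\<lambda>n. p (u n)) \<longlonglongrightarrow> lim (\<lambda>n. p (u n))"
proof -
  have "Cauchy (\<lambda>n. p (u n))"
  proof (rule CauchyI)
    fix e :: real
    assume "0 < e"
    then obtain N where "\<And>m n. m \<ge> N \<Longrightarrow> n \<ge> N \<Longrightarrow> p (u m - u n) < e"
      using assms unfolding cauchy_wrt_def by meson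
    then show "\<exists>M. \<forall>m\<ge>M. \<forall>n\<ge>M. norm (p (u m) - p (u n)) < e"
      using abs_diff_le by (metis le_less_trans real_norm_def)
  qed
  then show ?thesis using Cauchy_convergent_iff convergent_LIMSEQ_iff by blast
qed

lemma completion_rel_lim:
  assumes "completion_rel p u v"
  shows "lim (\<lambda>n. p (u n)) = lim (\<lambda>n. p (v n))"
proof -
  have "(\<lambda>n. p (u n) - p (v n)) \<longlonglongrightarrow> 0"
    by (rule Lim_null_comparison[of _ "\<lambda>n. p (u n - v n)"])
      (use assms abs_diff_le in \<open>auto simp: completion_rel_def\<close>)
  moreover have "(\<lambda>n. p (u n) - p (v n)) \<longlonglongrightarrow> lim (\<lambda>n. p (u n)) - lim (\<lambda>n. p (v n))"
    using assms by (intro tendsto_diff cauchy_tendsto_lim) (auto simp: completion_rel_def)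
  ultimately show ?thesis using LIMSEQ_unique by fastforce
qed

lemma lim_eq_0_iff:
  assumes "completion_rel p u u"
  shows "lim (\<lambda>n. p (u n)) = 0 \<longleftrightarrow> completion_rel p u (\<lambda>_. 0)"
  using assms cauchy_tendsto_lim[of u] limI[of "\<lambda>n. p (u n)" 0]
  by (auto simp: completion_rel_def cauchy_const)

lemma lim_add_le:
  assumes "completion_rel p u u" "completion_rel p v v"
  shows "lim (\<lambda>n. p (u n + v n)) \<le> lim (\<lambda>n. p (u n)) + lim (\<lambda>n. p (v n))"
proof (rule LIMSEQ_le)
  show "(\<lambda>n. p (u n + v n)) \<longlonglongrightarrow> lim (\<lambda>n. p (u n + v n))"
    using assms by (intro cauchy_tendsto_lim cauchy_add) (auto simp: completion_rel_def)
  show "(\<lambda>n. p (u n) + p (v n)) \<longlonglongrightarrow> lim (\<lambda>n. p (u n)) + lim (\<lambda>n. p (v n))"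
    using assms by (intro tendsto_add cauchy_tendsto_lim) (auto simp: completion_rel_def)
qed (use add_le in auto)

lemma lim_scaleR:
  assumes "completion_rel p u u"
  shows "lim (\<lambda>n. p (c *\<^sub>R u n)) = \<bar>c\<bar> * lim (\<lambda>n. p (u n))"
  unfolding scaleR_eq
  using assms by (intro limI tendsto_mult_left cauchy_tendsto_lim) (simp add: completion_rel_def)

lemma lim_diff_tendsto_0:
  assumes "cauchy_wrt p u"
  shows "(\<lambda>k. lim (\<lambda>n. p (u k - u n))) \<longlonglongrightarrow> 0"
proof (rule LIMSEQ_I)
  fix e :: real
  assume "0 < e"
  then obtain N where N: "\<And>m n. m \<ge> N \<Longrightarrow> n \<ge> N \<Longrightarrow> p (u m - u n) < e / 2"
    using assms unfolding cauchy_wrt_def by (meson half_gt_zero)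
  have "norm (lim (\<lambda>n. p (u k - u n)) - 0) < e" if "k \<ge> N" for k
  proof -
    have "cauchy_wrt p (\<lambda>n. u k + (-1) *\<^sub>R u n)"
      by (intro cauchy_add cauchy_const cauchy_scaleR assms)
    then have *: "(\<lambda>n. p (u k - u n)) \<longlonglongrightarrow> lim (\<lambda>n. p (u k - u n))"
      using cauchy_tendsto_lim by force
    have "lim (\<lambda>n. p (u k - u n)) \<le> e / 2"
      by (rule LIMSEQ_le_const2[OF *]) (use N[OF that] in \<open>auto intro!: exI[of _ N] less_imp_le\<close>)
    moreover have "0 \<le> lim (\<lambda>n. p (u k - u n))"
      by (rule LIMSEQ_le_const[OF *]) (simp add: nonneg)
    ultimately show ?thesis using \<open>0 < e\<close> by simp
  qed
  then show "\<exists>N. \<forall>k\<ge>N. norm (lim (\<lambda>n. p (u k - u n)) - 0) < e" by blast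
qed

end

lemma Cauchy_convergent_if_dense_image:
  fixes \<iota> :: "'s::real_vector \<Rightarrow> 'z::real_normed_vector"
    and X :: "nat \<Rightarrow> 'z"
  assumes X: "Cauchy X"
    and diff: "\<And>u v. \<iota> (u - v) = \<iota> u - \<iota> v"
    and norm: "\<And>u. norm (\<iota> u) = p u"
    and dense: "\<And>z e. 0 < e \<Longrightarrow> \<exists>u. norm (\<iota> u - z) < e"
    and conv: "\<And>u. cauchy_wrt p u \<Longrightarrow> convergent (\<lambda>n. \<iota> (u n))"
  shows "convergent X"
proof -
  have "\<exists>u. norm (\<iota> u - X n) < inverse (real (Suc n))" for n
    by (rule dense) simp
  then obtain u where u: "\<And>n. norm (\<iota> (u n) - X n) < inverse (real (Suc n))" by metis
  have "(\<lambda>n. norm (\<iota> (u n) - X n)) \<longlonglongrightarrow> 0"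
    by (rule tendsto_sandwich[OF _ _ tendsto_const LIMSEQ_inverse_real_of_nat])
      (use u less_imp_le in \<open>auto intro!: always_eventually simp del: of_nat_Suc\<close>)
  then have null: "(\<lambda>n. \<iota> (u n) - X n) \<longlonglongrightarrow> 0" by (rule tendsto_norm_zero_cancel)
  have "Cauchy (\<lambda>n. \<iota> (u n))"
  proof (rule metric_CauchyI)
    fix e :: real
    assume "0 < e"
    then have "0 < e / 3" by simp
    obtain M where M: "\<And>m n. m \<ge> M \<Longrightarrow> n \<ge> M \<Longrightarrow> dist (X m) (X n) < e / 3"
      using metric_CauchyD[OF X \<open>0 < e / 3\<close>] by blast
    obtain N where N: "\<And>n. n \<ge> N \<Longrightarrow> norm (\<iota> (u n) - X n) < e / 3"
      using LIMSEQ_D[OF null \<open>0 < e / 3\<close>] by auto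
    have "dist (\<iota> (u m)) (\<iota> (u n)) < e" if "m \<ge> max M N" "n \<ge> max M N" for m n
    proof -
      have "dist (X m) (X n) < e / 3" "dist (\<iota> (u m)) (X m) < e / 3" "dist (X n) (\<iota> (u n)) < e / 3"
        using M[of m n] N[of m] N[of n] that by (auto simp: dist_norm norm_minus_commute[of "X n"])
      then show ?thesis
        using dist_triangle[of "\<iota> (u m)" "\<iota> (u n)" "X m"] dist_triangle[of "X m" "\<iota> (u n)" "X n"]
        by linarith
    qed
    then show "\<exists>M. \<forall>m\<ge>M. \<forall>n\<ge>M. dist (\<iota> (u m)) (\<iota> (u n)) < e" by blast
  qed
  then have "cauchy_wrt p u"
    unfolding cauchy_wrt_def Cauchy_iff by (simp add: diff flip: norm)
  then obtain l where "(\<lambda>n. \<iota> (u n)) \<longlonglongrightarrow> l" using conv convergent_def by blast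
  from tendsto_diff[OF this null] show ?thesis by (auto simp: convergent_def)
qed


section \<open>The completed projective tensor product\<close>

quotient_type (overloaded) ('a, 'b) proj_tensor =
  "nat \<Rightarrow> ('a::real_normed_vector, 'b::real_normed_vector) tensor" / partial:
  "completion_rel (proj_norm UNIV UNIV)"
  by (rule proj_norm.part_equivp_completion_rel)

instantiation proj_tensor :: (real_normed_vector, real_normed_vector) real_normed_vector
begin

lift_definition zero_proj_tensor :: "('a, 'b) proj_tensor" is "\<lambda>_. 0"
  by (rule proj_norm.completion_rel_const)

lift_definition plus_proj_tensor ::
  "('a, 'b) proj_tensor \<Rightarrow> ('a, 'b) proj_tensor \<Rightarrow> ('a, 'b) proj_tensor"
  is "\<lambda>u v n. u n + v n"
  by (rule proj_norm.completion_rel_add)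

lift_definition scaleR_proj_tensor :: "real \<Rightarrow> ('a, 'b) proj_tensor \<Rightarrow> ('a, 'b) proj_tensor"
  is "\<lambda>c u n. c *\<^sub>R u n"
  by (rule proj_norm.completion_rel_scaleR)

lift_definition norm_proj_tensor :: "('a, 'b) proj_tensor \<Rightarrow> real"
  is "\<lambda>u. lim (\<lambda>n. proj_norm UNIV UNIV (u n))"
  by (rule proj_norm.completion_rel_lim)

definition uminus_proj_tensor :: "('a, 'b) proj_tensor \<Rightarrow> ('a, 'b) proj_tensor"
  where "uminus_proj_tensor z = (-1) *\<^sub>R z"

definition minus_proj_tensor ::
  "('a, 'b) proj_tensor \<Rightarrow> ('a, 'b) proj_tensor \<Rightarrow> ('a, 'b) proj_tensor"
  where "minus_proj_tensor z w = z + (- w)"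

definition sgn_proj_tensor :: "('a, 'b) proj_tensor \<Rightarrow> ('a, 'b) proj_tensor"
  where "sgn_proj_tensor z = inverse (norm z) *\<^sub>R z"

definition dist_proj_tensor :: "('a, 'b) proj_tensor \<Rightarrow> ('a, 'b) proj_tensor \<Rightarrow> real"
  where "dist_proj_tensor z w = norm (z - w)"

definition uniformity_proj_tensor :: "(('a, 'b) proj_tensor \<times> ('a, 'b) proj_tensor) filter"
  where "uniformity_proj_tensor = (INF e\<in>{0 <..}. principal {(x, y). dist x y < e})"

definition open_proj_tensor :: "('a, 'b) proj_tensor set \<Rightarrow> bool"
  where "open_proj_tensor S \<longleftrightarrow> (\<forall>x\<in>S. \<forall>\<^sub>F (x', y) in uniformity. x' = x \<longrightarrow> y \<in> S)"

instance
proof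
  fix u v w :: "('a, 'b) proj_tensor" and a b :: real and S :: "('a, 'b) proj_tensor set"
  show "u + v + w = u + (v + w)"
    by transfer (simp add: proj_norm.completion_rel_add add.assoc)
  show "u + v = v + u"
    by transfer (simp add: proj_norm.completion_rel_add add.commute)
  show "0 + u = u" by transfer simp
  show "- u + u = 0" unfolding uminus_proj_tensor_def
    by transfer (simp add: proj_norm.completion_rel_const)
  show "u - v = u + - v" by (simp add: minus_proj_tensor_def)
  show "a *\<^sub>R (u + v) = a *\<^sub>R u + a *\<^sub>R v"
    by transfer (simp add: proj_norm.completion_rel_add proj_norm.completion_rel_scaleR scaleR_right_distrib)
  show "(a + b) *\<^sub>R u = a *\<^sub>R u + b *\<^sub>R u"
    by transfer (simp add: proj_norm.completion_rel_add proj_norm.completion_rel_scaleR scaleR_left_distrib)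
  show "a *\<^sub>R b *\<^sub>R u = (a * b) *\<^sub>R u"
    by transfer (simp add: proj_norm.completion_rel_scaleR)
  show "1 *\<^sub>R u = u" by transfer simp
  show "sgn u = inverse (norm u) *\<^sub>R u" by (simp add: sgn_proj_tensor_def)
  show "dist u v = norm (u - v)" by (simp add: dist_proj_tensor_def)
  show "(uniformity :: (('a, 'b) proj_tensor \<times> ('a, 'b) proj_tensor) filter) =
      (INF e\<in>{0 <..}. principal {(x, y). dist x y < e})"
    by (simp add: uniformity_proj_tensor_def)
  show "open S = (\<forall>x\<in>S. \<forall>\<^sub>F (x', y) in uniformity. x' = x \<longrightarrow> y \<in> S)"
    by (simp add: open_proj_tensor_def)
  show "norm u = 0 \<longleftrightarrow> u = 0"
    by transfer (simp add: proj_norm.lim_eq_0_iff)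
  show "norm (u + v) \<le> norm u + norm v"
    by transfer (rule proj_norm.lim_add_le)
  show "norm (a *\<^sub>R u) = \<bar>a\<bar> * norm u"
    by transfer (rule proj_norm.lim_scaleR)
qed

end

lift_definition proj_embed ::
  "('a::real_normed_vector, 'b::real_normed_vector) tensor \<Rightarrow> ('a, 'b) proj_tensor"
  is "\<lambda>u _. u"
  by (rule proj_norm.completion_rel_const)

lemma proj_embed_add: "proj_embed (u + v) = proj_embed u + proj_embed v"
  by transfer (simp add: proj_norm.completion_rel_const)

lemma proj_embed_scaleR: "proj_embed (c *\<^sub>R u) = c *\<^sub>R proj_embed u"
  by transfer (simp add: proj_norm.completion_rel_const)

lemma proj_embed_diff: "proj_embed (u - v) = proj_embed u - proj_embed v"
  using proj_embed_add[of u "(-1) *\<^sub>R v"] proj_embed_scaleR[of "-1" v] by simp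

lemma norm_proj_embed: "norm (proj_embed u) = proj_norm UNIV UNIV u"
  by transfer simp

lemma proj_tensor_approx:
  fixes z :: "('a::real_normed_vector, 'b::real_normed_vector) proj_tensor"
  obtains u where "cauchy_wrt (proj_norm UNIV UNIV) u" "(\<lambda>n. proj_embed (u n)) \<longlonglongrightarrow> z"
    "z = abs_proj_tensor u"
proof -
  obtain u where u: "completion_rel (proj_norm UNIV UNIV) u u" "z = abs_proj_tensor u"
    using Quotient3_abs_rep[OF Quotient3_proj_tensor, of z] Quotient3_rep_reflp[OF Quotient3_proj_tensor, of z]
    by metis
  have "dist (proj_embed (u k)) z = lim (\<lambda>n. proj_norm UNIV UNIV (u k - u n))" for k
  proof -
    have "z - proj_embed (u k) = abs_proj_tensor (\<lambda>n. u n + (-1) *\<^sub>R u k)"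
      unfolding u(2) minus_proj_tensor_def uminus_proj_tensor_def proj_embed_def map_fun_def o_def id_def
      by (simp only: plus_proj_tensor.abs_eq[OF u(1) proj_norm.completion_rel_scaleR[OF proj_norm.completion_rel_const]]
        scaleR_proj_tensor.abs_eq[OF proj_norm.completion_rel_const])
    moreover have "completion_rel (proj_norm UNIV UNIV) (\<lambda>n. u n + (-1) *\<^sub>R u k) (\<lambda>n. u n + (-1) *\<^sub>R u k)"
      by (rule proj_norm.completion_rel_add[OF u(1) proj_norm.completion_rel_const])
    ultimately have "norm (z - proj_embed (u k)) = lim (\<lambda>n. proj_norm UNIV UNIV (u n + (-1) *\<^sub>R u k))"
      by (simp only: norm_proj_tensor.abs_eq)
    moreover have "proj_norm UNIV UNIV (u n + (-1) *\<^sub>R u k) = proj_norm UNIV UNIV (u k - u n)" for n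
      by (subst proj_norm.diff_commute) simp
    ultimately show ?thesis
      unfolding dist_norm norm_minus_commute[of "proj_embed (u k)" z] by (simp only:)
  qed
  moreover have "(\<lambda>k. lim (\<lambda>n. proj_norm UNIV UNIV (u k - u n))) \<longlonglongrightarrow> 0"
    using u(1) by (intro proj_norm.lim_diff_tendsto_0) (simp add: completion_rel_def)
  ultimately have "(\<lambda>n. proj_embed (u n)) \<longlonglongrightarrow> z"
    by (subst tendsto_dist_iff) simp
  moreover have "cauchy_wrt (proj_norm UNIV UNIV) u" using u(1) by (simp add: completion_rel_def)
  ultimately show thesis using u(2) that by blast
qed

lemma proj_embed_convergent:
  assumes "cauchy_wrt (proj_norm UNIV UNIV) u"
  shows "(\<lambda>n. proj_embed (u n)) \<longlonglongrightarrow> abs_proj_tensor u"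
proof -
  obtain v where v: "cauchy_wrt (proj_norm UNIV UNIV) v"
      "(\<lambda>n. proj_embed (v n)) \<longlonglongrightarrow> abs_proj_tensor u" "abs_proj_tensor u = abs_proj_tensor v"
    by (rule proj_tensor_approx)
  have "completion_rel (proj_norm UNIV UNIV) u v"
    using Quotient3_rel[OF Quotient3_proj_tensor, of u v] assms v
    by (simp add: proj_norm.completion_rel_refl)
  then have "(\<lambda>n. norm (proj_embed (u n) - proj_embed (v n))) \<longlonglongrightarrow> 0"
    by (simp add: completion_rel_def norm_proj_embed flip: proj_embed_diff)
  from tendsto_add[OF tendsto_norm_zero_cancel[OF this] v(2)] show ?thesis by simp
qed

instance proj_tensor :: (real_normed_vector, real_normed_vector) banach
proof
  fix X :: "nat \<Rightarrow> ('a, 'b) proj_tensor"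
  assume "Cauchy X"
  then show "convergent X"
  proof (rule Cauchy_convergent_if_dense_image[where \<iota> = proj_embed and p = "proj_norm UNIV UNIV"])
    fix z :: "('a, 'b) proj_tensor" and e :: real
    assume "0 < e"
    obtain u where "(\<lambda>n. proj_embed (u n)) \<longlonglongrightarrow> z" by (rule proj_tensor_approx)
    from LIMSEQ_D[OF this \<open>0 < e\<close>] show "\<exists>u. norm (proj_embed u - z) < e" by blast
  next
    fix u :: "nat \<Rightarrow> ('a, 'b) tensor"
    assume "cauchy_wrt (proj_norm UNIV UNIV) u"
    then show "convergent (\<lambda>n. proj_embed (u n))"
      using proj_embed_convergent convergentI by blast
  qed (simp_all add: proj_embed_diff norm_proj_embed)
qed


section \<open>The completed injective tensor product\<close>

quotient_type (overloaded) ('a, 'b) inj_tensor =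
  "nat \<Rightarrow> ('a::real_normed_vector, 'b::real_normed_vector) tensor" / partial:
  "completion_rel (inj_norm UNIV UNIV)"
  by (rule inj_norm.part_equivp_completion_rel)

instantiation inj_tensor :: (real_normed_vector, real_normed_vector) real_normed_vector
begin

lift_definition zero_inj_tensor :: "('a, 'b) inj_tensor" is "\<lambda>_. 0"
  by (rule inj_norm.completion_rel_const)

lift_definition plus_inj_tensor ::
  "('a, 'b) inj_tensor \<Rightarrow> ('a, 'b) inj_tensor \<Rightarrow> ('a, 'b) inj_tensor"
  is "\<lambda>u v n. u n + v n"
  by (rule inj_norm.completion_rel_add)

lift_definition scaleR_inj_tensor :: "real \<Rightarrow> ('a, 'b) inj_tensor \<Rightarrow> ('a, 'b) inj_tensor"
  is "\<lambda>c u n. c *\<^sub>R u n"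
  by (rule inj_norm.completion_rel_scaleR)

lift_definition norm_inj_tensor :: "('a, 'b) inj_tensor \<Rightarrow> real"
  is "\<lambda>u. lim (\<lambda>n. inj_norm UNIV UNIV (u n))"
  by (rule inj_norm.completion_rel_lim)

definition uminus_inj_tensor :: "('a, 'b) inj_tensor \<Rightarrow> ('a, 'b) inj_tensor"
  where "uminus_inj_tensor z = (-1) *\<^sub>R z"

definition minus_inj_tensor ::
  "('a, 'b) inj_tensor \<Rightarrow> ('a, 'b) inj_tensor \<Rightarrow> ('a, 'b) inj_tensor"
  where "minus_inj_tensor z w = z + (- w)"

definition sgn_inj_tensor :: "('a, 'b) inj_tensor \<Rightarrow> ('a, 'b) inj_tensor"
  where "sgn_inj_tensor z = inverse (norm z) *\<^sub>R z"

definition dist_inj_tensor :: "('a, 'b) inj_tensor \<Rightarrow> ('a, 'b) inj_tensor \<Rightarrow> real"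
  where "dist_inj_tensor z w = norm (z - w)"

definition uniformity_inj_tensor :: "(('a, 'b) inj_tensor \<times> ('a, 'b) inj_tensor) filter"
  where "uniformity_inj_tensor = (INF e\<in>{0 <..}. principal {(x, y). dist x y < e})"

definition open_inj_tensor :: "('a, 'b) inj_tensor set \<Rightarrow> bool"
  where "open_inj_tensor S \<longleftrightarrow> (\<forall>x\<in>S. \<forall>\<^sub>F (x', y) in uniformity. x' = x \<longrightarrow> y \<in> S)"

instance
proof
  fix u v w :: "('a, 'b) inj_tensor" and a b :: real and S :: "('a, 'b) inj_tensor set"
  show "u + v + w = u + (v + w)"
    by transfer (simp add: inj_norm.completion_rel_add add.assoc)
  show "u + v = v + u"
    by transfer (simp add: inj_norm.completion_rel_add add.commute)
  show "0 + u = u" by transfer simp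
  show "- u + u = 0" unfolding uminus_inj_tensor_def
    by transfer (simp add: inj_norm.completion_rel_const)
  show "u - v = u + - v" by (simp add: minus_inj_tensor_def)
  show "a *\<^sub>R (u + v) = a *\<^sub>R u + a *\<^sub>R v"
    by transfer (simp add: inj_norm.completion_rel_add inj_norm.completion_rel_scaleR scaleR_right_distrib)
  show "(a + b) *\<^sub>R u = a *\<^sub>R u + b *\<^sub>R u"
    by transfer (simp add: inj_norm.completion_rel_add inj_norm.completion_rel_scaleR scaleR_left_distrib)
  show "a *\<^sub>R b *\<^sub>R u = (a * b) *\<^sub>R u"
    by transfer (simp add: inj_norm.completion_rel_scaleR)
  show "1 *\<^sub>R u = u" by transfer simp
  show "sgn u = inverse (norm u) *\<^sub>R u" by (simp add: sgn_inj_tensor_def)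
  show "dist u v = norm (u - v)" by (simp add: dist_inj_tensor_def)
  show "(uniformity :: (('a, 'b) inj_tensor \<times> ('a, 'b) inj_tensor) filter) =
      (INF e\<in>{0 <..}. principal {(x, y). dist x y < e})"
    by (simp add: uniformity_inj_tensor_def)
  show "open S = (\<forall>x\<in>S. \<forall>\<^sub>F (x', y) in uniformity. x' = x \<longrightarrow> y \<in> S)"
    by (simp add: open_inj_tensor_def)
  show "norm u = 0 \<longleftrightarrow> u = 0"
    by transfer (simp add: inj_norm.lim_eq_0_iff)
  show "norm (u + v) \<le> norm u + norm v"
    by transfer (rule inj_norm.lim_add_le)
  show "norm (a *\<^sub>R u) = \<bar>a\<bar> * norm u"
    by transfer (rule inj_norm.lim_scaleR)
qed

end

lift_definition inj_embed ::
  "('a::real_normed_vector, 'b::real_normed_vector) tensor \<Rightarrow> ('a, 'b) inj_tensor"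
  is "\<lambda>u _. u"
  by (rule inj_norm.completion_rel_const)

lemma inj_embed_add: "inj_embed (u + v) = inj_embed u + inj_embed v"
  by transfer (simp add: inj_norm.completion_rel_const)

lemma inj_embed_scaleR: "inj_embed (c *\<^sub>R u) = c *\<^sub>R inj_embed u"
  by transfer (simp add: inj_norm.completion_rel_const)

lemma inj_embed_diff: "inj_embed (u - v) = inj_embed u - inj_embed v"
  using inj_embed_add[of u "(-1) *\<^sub>R v"] inj_embed_scaleR[of "-1" v] by simp

lemma norm_inj_embed: "norm (inj_embed u) = inj_norm UNIV UNIV u"
  by transfer simp

lemma inj_tensor_approx:
  fixes z :: "('a::real_normed_vector, 'b::real_normed_vector) inj_tensor"
  obtains u where "cauchy_wrt (inj_norm UNIV UNIV) u" "(\<lambda>n. inj_embed (u n)) \<longlonglongrightarrow> z"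
    "z = abs_inj_tensor u"
proof -
  obtain u where u: "completion_rel (inj_norm UNIV UNIV) u u" "z = abs_inj_tensor u"
    using Quotient3_abs_rep[OF Quotient3_inj_tensor, of z] Quotient3_rep_reflp[OF Quotient3_inj_tensor, of z]
    by metis
  have "dist (inj_embed (u k)) z = lim (\<lambda>n. inj_norm UNIV UNIV (u k - u n))" for k
  proof -
    have "z - inj_embed (u k) = abs_inj_tensor (\<lambda>n. u n + (-1) *\<^sub>R u k)"
      unfolding u(2) minus_inj_tensor_def uminus_inj_tensor_def inj_embed_def map_fun_def o_def id_def
      by (simp only: plus_inj_tensor.abs_eq[OF u(1) inj_norm.completion_rel_scaleR[OF inj_norm.completion_rel_const]]
        scaleR_inj_tensor.abs_eq[OF inj_norm.completion_rel_const])
    moreover have "completion_rel (inj_norm UNIV UNIV) (\<lambda>n. u n + (-1) *\<^sub>R u k) (\<lambda>n. u n + (-1) *\<^sub>R u k)"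
      by (rule inj_norm.completion_rel_add[OF u(1) inj_norm.completion_rel_const])
    ultimately have "norm (z - inj_embed (u k)) = lim (\<lambda>n. inj_norm UNIV UNIV (u n + (-1) *\<^sub>R u k))"
      by (simp only: norm_inj_tensor.abs_eq)
    moreover have "inj_norm UNIV UNIV (u n + (-1) *\<^sub>R u k) = inj_norm UNIV UNIV (u k - u n)" for n
      by (subst inj_norm.diff_commute) simp
    ultimately show ?thesis
      unfolding dist_norm norm_minus_commute[of "inj_embed (u k)" z] by (simp only:)
  qed
  moreover have "(\<lambda>k. lim (\<lambda>n. inj_norm UNIV UNIV (u k - u n))) \<longlonglongrightarrow> 0"
    using u(1) by (intro inj_norm.lim_diff_tendsto_0) (simp add: completion_rel_def)
  ultimately have "(\<lambda>n. inj_embed (u n)) \<longlonglongrightarrow> z"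
    by (subst tendsto_dist_iff) simp
  moreover have "cauchy_wrt (inj_norm UNIV UNIV) u" using u(1) by (simp add: completion_rel_def)
  ultimately show thesis using u(2) that by blast
qed

lemma inj_embed_convergent:
  assumes "cauchy_wrt (inj_norm UNIV UNIV) u"
  shows "(\<lambda>n. inj_embed (u n)) \<longlonglongrightarrow> abs_inj_tensor u"
proof -
  obtain v where v: "cauchy_wrt (inj_norm UNIV UNIV) v"
      "(\<lambda>n. inj_embed (v n)) \<longlonglongrightarrow> abs_inj_tensor u" "abs_inj_tensor u = abs_inj_tensor v"
    by (rule inj_tensor_approx)
  have "completion_rel (inj_norm UNIV UNIV) u v"
    using Quotient3_rel[OF Quotient3_inj_tensor, of u v] assms v
    by (simp add: inj_norm.completion_rel_refl)
  then have "(\<lambda>n. norm (inj_embed (u n) - inj_embed (v n))) \<longlonglongrightarrow> 0"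
    by (simp add: completion_rel_def norm_inj_embed flip: inj_embed_diff)
  from tendsto_add[OF tendsto_norm_zero_cancel[OF this] v(2)] show ?thesis by simp
qed

instance inj_tensor :: (real_normed_vector, real_normed_vector) banach
proof
  fix X :: "nat \<Rightarrow> ('a, 'b) inj_tensor"
  assume "Cauchy X"
  then show "convergent X"
  proof (rule Cauchy_convergent_if_dense_image[where \<iota> = inj_embed and p = "inj_norm UNIV UNIV"])
    fix z :: "('a, 'b) inj_tensor" and e :: real
    assume "0 < e"
    obtain u where "(\<lambda>n. inj_embed (u n)) \<longlonglongrightarrow> z" by (rule inj_tensor_approx)
    from LIMSEQ_D[OF this \<open>0 < e\<close>] show "\<exists>u. norm (inj_embed u - z) < e" by blast
  next
    fix u :: "nat \<Rightarrow> ('a, 'b) tensor"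
    assume "cauchy_wrt (inj_norm UNIV UNIV) u"
    then show "convergent (\<lambda>n. inj_embed (u n))"
      using inj_embed_convergent convergentI by blast
  qed (simp_all add: inj_embed_diff norm_inj_embed)
qed


section \<open>Tensor products of subspaces\<close>

text \<open>An element of the completion of \<open>S\<close> with respect to \<open>p\<close> is represented by a \<open>p\<close>-Cauchy sequence
  in \<open>S\<close>; the continuous extension of \<open>\<iota>\<close> sends it to the limit of its image. So this is the range of
  that extension.\<close>

definition completion_range ::
  "('s::real_vector \<Rightarrow> real) \<Rightarrow> 's set \<Rightarrow> ('s \<Rightarrow> 'z::real_normed_vector) \<Rightarrow> 'z set"
  where "completion_range p S \<iota> =
    {z. \<exists>u. range u \<subseteq> S \<and> cauchy_wrt p u \<and> (\<lambda>n. \<iota> (u n)) \<longlonglongrightarrow> z}"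

text \<open>The completed tensor products of subspaces \<open>E\<close> and \<open>F\<close>, each with its own norm, as subspaces of
  the completed tensor products of the whole spaces through the canonical map.\<close>

definition proj_tensor_of ::
  "'a::real_normed_vector set \<Rightarrow> 'b::real_normed_vector set \<Rightarrow> ('a, 'b) proj_tensor set"
  where "proj_tensor_of E F = completion_range (proj_norm E F) (alg_tensor E F) proj_embed"

definition inj_tensor_of ::
  "'a::real_normed_vector set \<Rightarrow> 'b::real_normed_vector set \<Rightarrow> ('a, 'b) inj_tensor set"
  where "inj_tensor_of E F = completion_range (inj_norm E F) (alg_tensor E F) inj_embed"

end

theory Submission
  imports Defs
begin

text \<open>The operator on a small subspace \<open>G\<close> of a completed tensor product is \<open>f \<otimes> g\<close>, where \<open>f\<close> and
  \<open>g\<close> are contractions that the ideal property of \<open>E\<close> and \<open>F\<close> provides on small subspaces \<open>S\<close> of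
  \<open>X\<close> and \<open>T\<close> of \<open>Y\<close>. The subspaces \<open>S\<close> and \<open>T\<close> are spanned by the entries of a family of fewer
  than \<open>\<kappa>\<close> representations \<open>\<Sum> x\<^sub>i \<otimes> y\<^sub>i\<close>, and everything depends on putting enough of
  them into the family. Since \<open>\<kappa>\<close> is uncountable, countably many may be spent on each of fewer than
  \<open>\<kappa>\<close> elements.

  The elements to be treated are algebraic tensors approximating a dense subset of \<open>G\<close> and, by tensors
  of \<open>E \<otimes> F\<close>, a dense subset of the intersection of \<open>G\<close> with the completion of \<open>E \<otimes> F\<close>; the second
  kind makes the operator the identity on that intersection. They are closed under rational linear
  combinations, which costs no cardinality. An algebraic operator that contracts all these
  tensors contracts their real span by density, hence extends to the closure, which contains \<open>G\<close>.
  This part does not depend on the tensor norm and is \<open>kappa_ideal_closureI\<close>.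

  What remains is that \<open>f \<otimes> g\<close> contracts the chosen tensors. For the projective norm, the family
  contains for each tensor \<open>d\<close> representations whose cost \<open>\<Sum> \<parallel>x\<^sub>i\<parallel> \<parallel>y\<^sub>i\<parallel>\<close> comes arbitrarily close to
  the norm of \<open>d\<close> in the whole space; \<open>f\<close> and \<open>g\<close> do not increase the cost. For the injective norm,
  one representation of each tensor suffices: functionals \<open>\<phi> \<circ> f\<close> on \<open>S\<close> and \<open>\<psi> \<circ> g\<close> on \<open>T\<close> extend to
  functionals on the whole spaces without increase of the norm (\<open>dual_ball_extension\<close>, the
  Hahn-Banach theorem).

  The same two arguments show that the intrinsic norms of \<open>E \<otimes> F\<close> are the restrictions of the norms of
  the whole tensor products, so that the completed tensor product of \<open>E\<close> and \<open>F\<close> is the closure of the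
  algebraic one (\<open>completion_range_eq_closure\<close>).\<close>

section \<open>The Hahn-Banach theorem\<close>

text \<open>Functionals of norm at most one on subspaces are encoded as linear subspaces of \<open>'a \<times> real\<close> lying
  below the graph of the norm. Such a subspace is automatically a graph, because it meets the fibre over
  \<open>0\<close> in a subspace of \<open>{..0}\<close>. Extending it over \<open>x0\<close> is possible because the triangle inequality puts
  all lower bounds for the new value \<open>c\<close> below all upper bounds.\<close>

lemma graph_one_step_extension:
  fixes M :: "('a::real_normed_vector \<times> real) set"
  assumes M: "subspace M" and bound: "\<And>x r. (x, r) \<in> M \<Longrightarrow> r \<le> norm x"
  obtains M' c where "subspace M'" "M \<subseteq> M'" "(x0, c) \<in> M'" "\<forall>(x, r)\<in>M'. r \<le> norm x"
proof -
  define C where "C = (\<lambda>(x, r). norm (x + x0) - r) ` M"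
  have cross: "r' - norm (x' - x0) \<le> norm (x + x0) - r" if "(x, r) \<in> M" "(x', r') \<in> M" for x r x' r'
  proof -
    have "(x + x', r + r') \<in> M" using subspace_add[OF M that] by simp
    then have "r + r' \<le> norm ((x + x0) + (x' - x0))" using bound by simp
    also have "\<dots> \<le> norm (x + x0) + norm (x' - x0)" by (rule norm_triangle_ineq)
    finally show ?thesis by simp
  qed
  have zero: "(0, 0) \<in> M" using subspace_0[OF M] by (simp add: zero_prod_def)
  then have "C \<noteq> {}" by (auto simp: C_def)
  have "bdd_below C"
    by (rule bdd_belowI[of _ "0 - norm (0 - x0)"]) (use cross[OF _ zero] in \<open>auto simp: C_def\<close>)
  define c where "c = Inf C"
  have upper: "c \<le> norm (x + x0) - r" if "(x, r) \<in> M" for x r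
    unfolding c_def by (rule cInf_lower[OF _ \<open>bdd_below C\<close>]) (use that in \<open>force simp: C_def\<close>)
  have lower: "r - norm (x - x0) \<le> c" if "(x, r) \<in> M" for x r
    unfolding c_def by (rule cInf_greatest) (use that \<open>C \<noteq> {}\<close> cross in \<open>auto simp: C_def\<close>)
  define M' where "M' = {u + v |u v. u \<in> M \<and> v \<in> span {(x0, c)}}"
  have "subspace M'" unfolding M'_def by (rule subspace_sums[OF M subspace_span])
  moreover have "M \<subseteq> M'" unfolding M'_def using span_zero by (metis (mono_tags, lifting) add.right_neutral mem_Collect_eq subsetI)
  moreover have "(x0, c) \<in> M'"
    unfolding M'_def using span_base[of "(x0, c)"] subspace_0[OF M]
    by (metis (mono_tags, lifting) add.left_neutral mem_Collect_eq singletonI)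
  moreover have "\<forall>(x, r)\<in>M'. r \<le> norm x"
  proof clarify
    fix x r
    assume "(x, r) \<in> M'"
    show "r \<le> norm x"
    proof -
      obtain y s t where ys: "(y, s) \<in> M" and eq: "x = y + t *\<^sub>R x0" "r = s + t * c"
        using \<open>(x, r) \<in> M'\<close> by (auto simp: M'_def span_singleton)
      have scaled: "(a *\<^sub>R y, a * s) \<in> M" for a using subspace_scale[OF M ys, of a] by simp
      consider "t = 0" | "t > 0" | "t < 0" by linarith
      then show ?thesis
      proof cases
        case 1
        then show ?thesis using bound[OF ys] eq by simp
      next
        case 2
        have "c + inverse t * s \<le> norm (inverse t *\<^sub>R y + x0)"
          using upper[OF scaled[of "inverse t"]] by simp
        then have "t * (c + inverse t * s) \<le> t * norm (inverse t *\<^sub>R y + x0)"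
          using 2 by simp
        also have "\<dots> = norm (t *\<^sub>R (inverse t *\<^sub>R y + x0))" using 2 by simp
        finally show ?thesis using 2 by (simp add: eq algebra_simps)
      next
        case 3
        have "inverse (-t) * s - c \<le> norm (inverse (-t) *\<^sub>R y - x0)"
          using lower[OF scaled[of "inverse (-t)"]] by simp
        then have "(-t) * (inverse (-t) * s - c) \<le> (-t) * norm (inverse (-t) *\<^sub>R y - x0)"
          using 3 by (intro mult_left_mono) auto
        also have "\<dots> = norm ((-t) *\<^sub>R (inverse (-t) *\<^sub>R y - x0))" using 3 by simp
        finally show ?thesis using 3 by (simp add: eq algebra_simps)
      qed
    qed
  qed
  ultimately show thesis by (rule that)
qed

text \<open>The Hahn-Banach theorem for functionals of norm at most one, by Zorn's lemma on graphs.\<close>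

theorem dual_ball_extension:
  assumes E: "subspace E" and \<phi>: "\<phi> \<in> dual_ball E"
  obtains \<Phi> where "\<Phi> \<in> dual_ball UNIV" "\<And>x. x \<in> E \<Longrightarrow> \<Phi> x = \<phi> x"
proof -
  define graph where "graph = (\<lambda>x. (x, \<phi> x)) ` E"
  define \<A> where "\<A> = {M. subspace M \<and> graph \<subseteq> M \<and> (\<forall>(x, r)\<in>M. r \<le> norm x)}"
  have "\<exists>M\<in>\<A>. \<forall>X\<in>\<A>. M \<subseteq> X \<longrightarrow> X = M"
  proof (rule subset_Zorn_nonempty)
    have "\<phi> x \<le> norm x" if "x \<in> E" for x using \<phi> that by (force simp: dual_ball_def)
    moreover have "subspace graph"
      using E \<phi> unfolding graph_def subspace_def dual_ball_def linear_between_def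
      by (auto simp: zero_prod_def image_iff)
    ultimately have "graph \<in> \<A>" by (auto simp: \<A>_def graph_def)
    then show "\<A> \<noteq> {}" by blast
  next
    fix \<C> assume ne: "\<C> \<noteq> {}" and chain: "subset.chain \<A> \<C>"
    have sub: "subspace M" "graph \<subseteq> M" "\<forall>(x, r)\<in>M. r \<le> norm x" if "M \<in> \<C>" for M
      using chain that unfolding subset.chain_def \<A>_def by blast+
    have "u + v \<in> \<Union>\<C>" if uv: "u \<in> \<Union>\<C>" "v \<in> \<Union>\<C>" for u v
    proof -
      obtain M N where MN: "u \<in> M" "v \<in> N" "M \<in> \<C>" "N \<in> \<C>" using uv by blast
      then have "M \<subseteq> N \<or> N \<subseteq> M" using chain unfolding subset.chain_def by blast
      then show ?thesis
      proof
        assume "M \<subseteq> N"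
        then show ?thesis using MN subspace_add[OF sub(1)[of N]] by blast
      next
        assume "N \<subseteq> M"
        then show ?thesis using MN subspace_add[OF sub(1)[of M]] by blast
      qed
    qed
    moreover have "a *\<^sub>R u \<in> \<Union>\<C>" if "u \<in> \<Union>\<C>" for a u
      using that subspace_scale[OF sub(1)] by blast
    moreover have "0 \<in> \<Union>\<C>" using ne subspace_0[OF sub(1)] by blast
    ultimately have "subspace (\<Union>\<C>)" unfolding subspace_def by blast
    moreover have "graph \<subseteq> \<Union>\<C>" using ne sub(2) by blast
    moreover have "\<forall>(x, r)\<in>\<Union>\<C>. r \<le> norm x" using sub(3) by blast
    ultimately show "\<Union>\<C> \<in> \<A>" by (simp add: \<A>_def)
  qed
  then obtain M where "M \<in> \<A>" and maximal: "\<And>X. X \<in> \<A> \<Longrightarrow> M \<subseteq> X \<Longrightarrow> X = M" by blast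
  then have M: "subspace M" "graph \<subseteq> M" and bound: "\<And>x r. (x, r) \<in> M \<Longrightarrow> r \<le> norm x"
    by (auto simp: \<A>_def)
  have "\<exists>c. (x, c) \<in> M" for x
  proof -
    obtain M' c where M': "subspace M'" "M \<subseteq> M'" "(x, c) \<in> M'" "\<forall>(x, r)\<in>M'. r \<le> norm x"
      by (rule graph_one_step_extension[of M x, OF M(1) bound])
    then have "M' \<in> \<A>" using M(2) unfolding \<A>_def by blast
    with M'(2) have "M' = M" by (rule maximal[rotated])
    then show ?thesis using M'(3) by blast
  qed
  then have "\<forall>x. \<exists>c. (x, c) \<in> M" by blast
  from choice[OF this] obtain \<Phi> where \<Phi>: "\<And>x. (x, \<Phi> x) \<in> M" by blast
  have unique: "r = s" if "(x, r) \<in> M" "(x, s) \<in> M" for x r s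
    using bound[of 0 "r - s"] bound[of 0 "s - r"] subspace_diff[OF M(1) that] subspace_diff[OF M(1) that(2,1)]
    by simp
  have "\<Phi> (x + y) = \<Phi> x + \<Phi> y" for x y
    using unique[OF \<Phi>] subspace_add[OF M(1) \<Phi> \<Phi>] by simp
  moreover have scale: "\<Phi> (c *\<^sub>R x) = c *\<^sub>R \<Phi> x" for c x
    using unique[OF \<Phi>] subspace_scale[OF M(1) \<Phi>] by simp
  moreover have "\<bar>\<Phi> x\<bar> \<le> norm x" for x
    using bound[OF \<Phi>, of x] bound[OF \<Phi>, of "- x"] scale[of "-1" x] by auto
  ultimately have "\<Phi> \<in> dual_ball UNIV" by (simp add: dual_ball_def linear_between_def)
  moreover have "\<Phi> x = \<phi> x" if "x \<in> E" for x
    using unique[OF \<Phi>] M(2) that by (auto simp: graph_def)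
  ultimately show thesis by (rule that)
qed


section \<open>Small sets and dense subsets\<close>

lemma infinite_Field_uncountable: "natLeq <o \<kappa> \<Longrightarrow> infinite (Field \<kappa>)"
  using cinfinite_mono[OF ordLess_imp_ordLeq natLeq_cinfinite] by (simp add: cinfinite_def)

lemma ordLess_Plus_nat:
  assumes \<kappa>: "Card_order \<kappa>" "natLeq <o \<kappa>" and "|A| <o \<kappa>"
  shows "|A <+> (UNIV :: nat set)| <o \<kappa>"
  by (rule card_of_Plus_ordLess_infinite_Field)
    (use assms infinite_Field_uncountable card_of_nat ordIso_ordLess_trans in blast)+

text \<open>The infinite cardinal \<open>|A| + \<aleph>\<^sub>0\<close> lies below \<open>\<kappa>\<close>, even for singular \<open>\<kappa>\<close>, and absorbs the product.\<close>

lemma ordLess_times_nat: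
  assumes \<kappa>: "Card_order \<kappa>" "natLeq <o \<kappa>" and "|A| <o \<kappa>"
  shows "|A \<times> (UNIV :: nat set)| <o \<kappa>"
proof -
  let ?C = "A <+> (UNIV :: nat set)"
  have "infinite ?C" by (simp add: finite_Plus_iff)
  then have "|A \<times> (UNIV :: nat set)| \<le>o |?C|"
    by (intro card_of_Times_ordLeq_infinite_Field card_of_Plus1 card_of_Plus2 card_of_Card_order)
      (simp add: Field_card_of)
  then show ?thesis using ordLess_Plus_nat[OF assms] ordLeq_ordLess_trans by blast
qed

lemma ordLess_image_times_nat:
  assumes "Card_order \<kappa>" "natLeq <o \<kappa>" and "|A| <o \<kappa>"
  shows "|(\<lambda>(a, n::nat). f a n) ` (A \<times> UNIV)| <o \<kappa>"
  using ordLess_times_nat[OF assms] card_of_image ordLeq_ordLess_trans by blast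

lemma ordLess_Un:
  assumes \<kappa>: "Card_order \<kappa>" "natLeq <o \<kappa>" and "|A| <o \<kappa>" "|B| <o \<kappa>"
  shows "|A \<union> B| <o \<kappa>"
proof (rule card_of_Un_ordLess_infinite_Field)
  show "infinite (Field \<kappa>)"
    using \<kappa>(2) by (rule infinite_Field_uncountable)
qed (use assms in auto)

lemma ordLess_finite:
  assumes "natLeq <o \<kappa>" "finite A"
  shows "|A| <o \<kappa>"
  using assms ordLess_transitive finite_iff_ordLess_natLeq by blast

text \<open>Rational combinations are as few as the generators, yet dense in the real span for every
  seminorm.\<close>

inductive_set rat_span :: "'s::real_vector set \<Rightarrow> 's set" for A where
  zero: "0 \<in> rat_span A"
| step: "a \<in> A \<Longrightarrow> x \<in> rat_span A \<Longrightarrow> of_rat q *\<^sub>R a + x \<in> rat_span A"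

lemma rat_span_superset: "A \<subseteq> rat_span A"
  using rat_span.step[OF _ rat_span.zero, where q = 1] by auto

lemma ordLess_rat_span:
  assumes \<kappa>: "Card_order \<kappa>" "natLeq <o \<kappa>" and A: "|A| <o \<kappa>"
  shows "|rat_span A| <o \<kappa>"
proof -
  \<comment> \<open>\<open>R n\<close> consists of the combinations of \<open>n\<close> terms; a rational is coded by a natural number.\<close>
  define B where "B = A \<times> (UNIV :: nat set)"
  define R where "R = rec_nat {0} (\<lambda>_ S. (\<lambda>((a, n), x). of_rat (from_nat n) *\<^sub>R a + x) ` (B \<times> S))"
  have R_0: "R 0 = {0}"
    and R_Suc: "R (Suc n) = (\<lambda>((a, n), x). of_rat (from_nat n) *\<^sub>R a + x) ` (B \<times> R n)" for n
    by (simp_all add: R_def)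
  let ?C = "B <+> (UNIV :: nat set)"
  have inf: "infinite ?C" by (simp add: finite_Plus_iff)
  have B_le: "|B| \<le>o |?C|" by (rule card_of_Plus1)
  have R: "|R n| \<le>o |?C|" for n
  proof (induction n)
    case 0
    then show ?case using card_of_singl_ordLeq[of ?C 0] by (simp add: R_0)
  next
    case (Suc n)
    have "|B \<times> R n| \<le>o |?C|"
      using inf by (intro card_of_Times_ordLeq_infinite_Field B_le Suc card_of_Card_order)
        (simp add: Field_card_of)
    then show ?case
      unfolding R_Suc using card_of_image ordLeq_transitive by blast
  qed
  have "rat_span A \<subseteq> (\<Union>n. R n)"
  proof
    show "x \<in> (\<Union>n. R n)" if "x \<in> rat_span A" for x
      using that
    proof induction
      case zero
      have "0 \<in> R 0" by (simp add: R_0)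
      then show ?case by blast
    next
      case (step a x q)
      then obtain n where "x \<in> R n" by blast
      then have "of_rat (from_nat (to_nat q)) *\<^sub>R a + x \<in> R (Suc n)"
        unfolding R_Suc B_def using step.hyps by (intro image_eqI[of _ _ "((a, to_nat q), x)"]) auto
      then show ?case by (metis UNIV_I UN_I from_nat_to_nat)
    qed
  qed
  moreover have "|\<Union>n. R n| \<le>o |?C|"
    using inf R by (intro card_of_UNION_ordLeq_infinite) (auto intro: card_of_Plus2)
  moreover have "|?C| <o \<kappa>"
    unfolding B_def by (intro ordLess_Plus_nat ordLess_times_nat assms)
  ultimately show ?thesis
    by (meson card_of_mono1 ordLeq_ordLess_trans ordLeq_transitive)
qed

lemma rat_span_approx:
  fixes q :: "'s::real_vector \<Rightarrow> real"
  assumes "seminorm q" "u \<in> span A" "0 < e"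
  obtains d where "d \<in> rat_span A" "q (u - d) < e"
proof -
  interpret seminorm q by fact
  have "\<forall>e>0. \<exists>d\<in>rat_span A. q (u - d) < e"
    using assms(2)
  proof (induction rule: span_induct_alt)
    case base
    then show ?case by (intro allI impI bexI[of _ 0]) (auto intro: rat_span.zero)
  next
    case (step c a y)
    show ?case
    proof (intro allI impI)
      fix e :: real
      assume "0 < e"
      then obtain d where d: "d \<in> rat_span A" "q (y - d) < e / 2"
        using step.IH half_gt_zero by blast
      have "0 < e / (2 * (q a + 1))" using \<open>0 < e\<close> nonneg[of a] by simp
      then obtain r where r: "c < of_rat r" "of_rat r < c + e / (2 * (q a + 1))"
        using of_rat_dense[of c "c + e / (2 * (q a + 1))"] by auto
      have "q (c *\<^sub>R a + y - (of_rat r *\<^sub>R a + d)) = q ((c - of_rat r) *\<^sub>R a + (y - d))"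
        by (simp add: algebra_simps)
      also have "\<dots> \<le> \<bar>c - of_rat r\<bar> * q a + q (y - d)"
        using add_le[of "(c - of_rat r) *\<^sub>R a" "y - d"] by (simp add: scaleR_eq)
      also have "\<bar>c - of_rat r\<bar> * q a \<le> e / (2 * (q a + 1)) * (q a + 1)"
        using r nonneg[of a] by (intro mult_mono) auto
      also have "e / (2 * (q a + 1)) * (q a + 1) = e / 2"
        using nonneg[of a] by (simp add: field_simps)
      finally have "q (c *\<^sub>R a + y - (of_rat r *\<^sub>R a + d)) < e" using d(2) by simp
      then show "\<exists>d\<in>rat_span A. q (c *\<^sub>R a + y - d) < e"
        using rat_span.step[OF step.hyps d(1)] by blast
    qed
  qed
  with assms(3) that show thesis by blast
qed

text \<open>The set \<open>A\<close> need not meet \<open>M\<close>, so its rational combinations are moved into \<open>M\<close>: choose a point of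
  \<open>M\<close> in each ball of radius \<open>1 / (n + 1)\<close> around a rational combination that meets \<open>M\<close>.\<close>

lemma dense_subset_of_small_cardinality:
  fixes M :: "'z::real_normed_vector set"
  assumes \<kappa>: "Card_order \<kappa>" "natLeq <o \<kappa>" and A: "|A| <o \<kappa>" "M \<subseteq> closure (span A)"
  obtains B where "B \<subseteq> M" "M \<subseteq> closure B" "|B| <o \<kappa>"
proof -
  define near where "near a n = {b \<in> M. dist a b < inverse (Suc n)}" for a n
  define pick where "pick a n = (SOME b. b \<in> near a n)" for a n
  define I where "I = {(a, n) \<in> rat_span A \<times> UNIV. near a n \<noteq> {}}"
  define B where "B = (\<lambda>(a, n). pick a n) ` I"
  have pick: "pick a n \<in> near a n" if "near a n \<noteq> {}" for a n
    using that unfolding pick_def by (auto intro: someI)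
  then have "B \<subseteq> M" by (force simp: B_def I_def near_def)
  have "|B| \<le>o |I|" unfolding B_def by (rule card_of_image)
  also have "|I| \<le>o |rat_span A \<times> (UNIV :: nat set)|" by (rule card_of_mono1) (auto simp: I_def)
  finally have "|B| <o \<kappa>"
    using ordLess_times_nat[OF \<kappa> ordLess_rat_span[OF \<kappa> A(1)]] ordLeq_ordLess_trans by blast
  have "\<exists>b\<in>B. dist b x < e" if "x \<in> M" "0 < e" for x e
  proof -
    obtain n where n: "inverse (real (Suc n)) < e / 2" using reals_Archimedean \<open>0 < e\<close> half_gt_zero by blast
    have pos: "0 < inverse (real (Suc n)) / 2" by simp
    obtain s where s: "s \<in> span A" "dist s x < inverse (real (Suc n)) / 2"
      using subsetD[OF A(2) \<open>x \<in> M\<close>] pos unfolding closure_approachable by blast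
    have "seminorm (norm :: 'z \<Rightarrow> real)" by unfold_locales (auto intro: norm_triangle_ineq)
    then obtain a where a: "a \<in> rat_span A" "norm (s - a) < inverse (real (Suc n)) / 2"
      using rat_span_approx[OF _ s(1) pos] by blast
    have ax: "dist a x < inverse (real (Suc n))"
      using s(2) a(2) dist_triangle[of a x s] by (simp add: dist_norm norm_minus_commute)
    then have "near a n \<noteq> {}" using that by (auto simp: near_def)
    then have "pick a n \<in> B" "dist a (pick a n) < inverse (Suc n)"
      using pick[of a n] a by (auto simp: B_def I_def near_def)
    moreover have "dist (pick a n) x < e"
      using dist_triangle[of "pick a n" x a] ax n calculation(2) by (simp add: dist_commute)
    ultimately show ?thesis by blast
  qed
  then have "M \<subseteq> closure B" by (auto simp: closure_approachable)
  with \<open>B \<subseteq> M\<close> \<open>|B| <o \<kappa>\<close> show thesis using that by blast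
qed


section \<open>A criterion for ideals of cardinal type\<close>

lemma subspace_closure:
  fixes S :: "'z::real_normed_vector set"
  assumes S: "subspace S"
  shows "subspace (closure S)"
proof (rule subspaceI)
  show "0 \<in> closure S" using subspace_0[OF S] closure_subset by blast
next
  fix x y assume "x \<in> closure S" "y \<in> closure S"
  then obtain u v where "\<And>n. u n \<in> S" "u \<longlonglongrightarrow> x" "\<And>n. v n \<in> S" "v \<longlonglongrightarrow> y"
    by (auto simp: closure_sequential)
  then show "x + y \<in> closure S"
    unfolding closure_sequential
    by (intro exI[of _ "\<lambda>n. u n + v n"]) (auto intro: subspace_add[OF S] tendsto_add)
next
  fix c :: real and x assume "x \<in> closure S"
  then obtain u where "\<And>n. u n \<in> S" "u \<longlonglongrightarrow> x" by (auto simp: closure_sequential)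
  then show "c *\<^sub>R x \<in> closure S"
    unfolding closure_sequential
    by (intro exI[of _ "\<lambda>n. c *\<^sub>R u n"]) (auto intro: subspace_scale[OF S] tendsto_scaleR)
qed

lemma closure_image_sequence:
  fixes f :: "'s \<Rightarrow> 'z::real_normed_vector"
  assumes "z \<in> closure (f ` S)"
  obtains u where "\<And>n::nat. u n \<in> S" "(\<lambda>n. f (u n)) \<longlonglongrightarrow> z"
proof -
  obtain v where v: "\<And>n::nat. v n \<in> f ` S" "v \<longlonglongrightarrow> z"
    using assms by (auto simp: closure_sequential)
  then have "\<forall>n. \<exists>s. s \<in> S \<and> v n = f s" by blast
  from choice[OF this] obtain u where "\<And>n. u n \<in> S \<and> v n = f (u n)" by blast
  moreover from this have "v = (\<lambda>n. f (u n))" by auto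
  ultimately show thesis using v(2) that[of u] by simp
qed

text \<open>If \<open>g\<close> is dominated by \<open>f\<close>, then \<open>f s \<mapsto> g s\<close> is a well-defined contraction on \<open>f ` S\<close>, even when
  \<open>f\<close> is not injective; \<open>P\<close> is its continuous extension. The last conclusion determines \<open>P\<close> by limits
  of sequences.\<close>

lemma dominated_linear_extends_to_closure:
  fixes f g :: "'s::real_vector \<Rightarrow> 'z::banach"
  assumes f: "linear f" and g: "linear g" and S: "subspace S"
    and le: "\<And>s. s \<in> S \<Longrightarrow> norm (g s) \<le> norm (f s)"
  obtains P where "linear_between (closure (f ` S)) (closure (g ` S)) P"
    "\<And>z. z \<in> closure (f ` S) \<Longrightarrow> norm (P z) \<le> norm z"
    "\<And>u z. (\<And>n::nat. u n \<in> S) \<Longrightarrow> (\<lambda>n. f (u n)) \<longlonglongrightarrow> z \<Longrightarrow> (\<lambda>n. g (u n)) \<longlonglongrightarrow> P z"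
proof -
  have le_diff: "norm (g s - g t) \<le> norm (f s - f t)" if "s \<in> S" "t \<in> S" for s t
    using le[OF subspace_diff[OF S that]] by (simp add: linear_diff f g)
  have "\<exists>l. \<forall>u. (\<forall>n. u n \<in> S) \<and> (\<lambda>n::nat. f (u n)) \<longlonglongrightarrow> z \<longrightarrow> (\<lambda>n. g (u n)) \<longlonglongrightarrow> l" for z
  proof (cases "\<exists>u. (\<forall>n. u n \<in> S) \<and> (\<lambda>n::nat. f (u n)) \<longlonglongrightarrow> z")
    case True
    then obtain v where v: "\<And>n::nat. v n \<in> S" "(\<lambda>n. f (v n)) \<longlonglongrightarrow> z" by blast
    have "Cauchy (\<lambda>n. g (v n))"
    proof (rule metric_CauchyI)
      fix e :: real
      assume "0 < e"
      then obtain N where "\<And>m n. m \<ge> N \<Longrightarrow> n \<ge> N \<Longrightarrow> dist (f (v m)) (f (v n)) < e"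
        using metric_CauchyD[OF LIMSEQ_imp_Cauchy[OF v(2)]] by blast
      then show "\<exists>N. \<forall>m\<ge>N. \<forall>n\<ge>N. dist (g (v m)) (g (v n)) < e"
        using le_diff[OF v(1) v(1)] unfolding dist_norm by (meson le_less_trans)
    qed
    then obtain l where l: "(\<lambda>n. g (v n)) \<longlonglongrightarrow> l"
      using Cauchy_convergent convergent_def by blast
    have "(\<lambda>n. g (u n)) \<longlonglongrightarrow> l" if u: "\<And>n. u n \<in> S" "(\<lambda>n. f (u n)) \<longlonglongrightarrow> z" for u
    proof -
      have "(\<lambda>n. f (u n) - f (v n)) \<longlonglongrightarrow> 0" using tendsto_diff[OF u(2) v(2)] by simp
      then have "(\<lambda>n. g (u n) - g (v n)) \<longlonglongrightarrow> 0"
        by (rule Lim_null_comparison[rotated, OF tendsto_norm_zero]) (simp add: le_diff u v)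
      from tendsto_add[OF this l] show ?thesis by simp
    qed
    then show ?thesis by blast
  qed blast
  then have "\<forall>z. \<exists>l. \<forall>u. (\<forall>n. u n \<in> S) \<and> (\<lambda>n::nat. f (u n)) \<longlonglongrightarrow> z \<longrightarrow> (\<lambda>n. g (u n)) \<longlonglongrightarrow> l" by blast
  from choice[OF this] obtain P where
    "\<forall>z u. (\<forall>n. u n \<in> S) \<and> (\<lambda>n::nat. f (u n)) \<longlonglongrightarrow> z \<longrightarrow> (\<lambda>n. g (u n)) \<longlonglongrightarrow> P z" by blast
  then have P: "(\<lambda>n. g (u n)) \<longlonglongrightarrow> P z" if "\<And>n::nat. u n \<in> S" "(\<lambda>n. f (u n)) \<longlonglongrightarrow> z" for u z
    using that by blast
  have "linear_between (closure (f ` S)) (closure (g ` S)) P"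
    unfolding linear_between_def
  proof (intro conjI ballI allI)
    show "P ` closure (f ` S) \<subseteq> closure (g ` S)"
    proof clarify
      fix z assume "z \<in> closure (f ` S)"
      then obtain u where u: "\<And>n::nat. u n \<in> S" "(\<lambda>n. f (u n)) \<longlonglongrightarrow> z"
        by (metis closure_image_sequence)
      show "P z \<in> closure (g ` S)"
        unfolding closure_sequential using P[OF u] u(1) by (intro exI[of _ "\<lambda>n. g (u n)"]) auto
    qed
  next
    fix x y assume x: "x \<in> closure (f ` S)" and y: "y \<in> closure (f ` S)"
    obtain u where u: "\<And>n::nat. u n \<in> S" "(\<lambda>n. f (u n)) \<longlonglongrightarrow> x"
      using x by (metis closure_image_sequence)
    obtain v where v: "\<And>n::nat. v n \<in> S" "(\<lambda>n. f (v n)) \<longlonglongrightarrow> y"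
      using y by (metis closure_image_sequence)
    have "(\<lambda>n. g (u n + v n)) \<longlonglongrightarrow> P (x + y)"
      using tendsto_add[OF u(2) v(2)] by (intro P) (auto simp: linear_add f intro: subspace_add[OF S] u v)
    moreover have "(\<lambda>n. g (u n + v n)) \<longlonglongrightarrow> P x + P y"
      using tendsto_add[OF P[OF u] P[OF v]] by (simp add: linear_add g)
    ultimately show "P (x + y) = P x + P y" by (rule LIMSEQ_unique)
  next
    fix c :: real and x assume x: "x \<in> closure (f ` S)"
    obtain u where u: "\<And>n::nat. u n \<in> S" "(\<lambda>n. f (u n)) \<longlonglongrightarrow> x"
      using x by (metis closure_image_sequence)
    have "(\<lambda>n. g (c *\<^sub>R u n)) \<longlonglongrightarrow> P (c *\<^sub>R x)"
      using tendsto_scaleR[OF tendsto_const u(2)]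
      by (intro P) (auto simp: linear_scale f intro: subspace_scale[OF S] u)
    moreover have "(\<lambda>n. g (c *\<^sub>R u n)) \<longlonglongrightarrow> c *\<^sub>R P x"
      using tendsto_scaleR[OF tendsto_const P[OF u]] by (simp add: linear_scale g)
    ultimately show "P (c *\<^sub>R x) = c *\<^sub>R P x" by (rule LIMSEQ_unique)
  qed
  moreover have "norm (P z) \<le> norm z" if z: "z \<in> closure (f ` S)" for z
  proof -
    obtain u where u: "\<And>n::nat. u n \<in> S" "(\<lambda>n. f (u n)) \<longlonglongrightarrow> z"
      using z by (metis closure_image_sequence)
    show ?thesis
      by (rule LIMSEQ_le[OF tendsto_norm[OF P[OF u]] tendsto_norm[OF u(2)]]) (auto intro: le u)
  qed
  ultimately show thesis using P by (rule that)
qed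

text \<open>The test sets \<open>D\<close> are arbitrary small sets of vectors of the dense space, and \<open>T\<close> has to be a
  contraction only at the points of \<open>D\<close>, not on its span: applying the hypothesis to the rational span
  of \<open>D\<close> and approximating real combinations by rational ones gives the estimate on the real span.\<close>

theorem kappa_ideal_closureI:
  fixes \<iota> :: "'s::real_vector \<Rightarrow> 'z::banach"
  assumes \<kappa>: "Card_order \<kappa>" "natLeq <o \<kappa>"
    and \<iota>: "linear \<iota>" and dense: "closure (range \<iota>) = UNIV" and Y: "subspace Y"
    and T: "\<And>D. |D| <o \<kappa> \<Longrightarrow> \<exists>T. linear T \<and> range T \<subseteq> Y \<and> (\<forall>d\<in>D \<inter> Y. T d = d) \<and>
      (\<forall>d\<in>D. norm (\<iota> (T d)) \<le> norm (\<iota> d))"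
  shows "kappa_ideal \<kappa> (closure (\<iota> ` Y))"
  unfolding kappa_ideal_def
proof (intro conjI allI impI)
  show "subspace (closure (\<iota> ` Y))"
    by (intro subspace_closure linear_subspace_image \<iota> Y)
next
  fix G :: "'z set"
  assume "subspace G \<and> dens G <o \<kappa>"
  then obtain A where A: "A \<subseteq> G" "G \<subseteq> closure (span A)" "|A| <o \<kappa>"
    by (auto simp: dens_less_iff[OF \<kappa>(1)])
  then have "G \<inter> closure (\<iota> ` Y) \<subseteq> closure (span A)" by blast
  then obtain B where B: "B \<subseteq> G \<inter> closure (\<iota> ` Y)" "G \<inter> closure (\<iota> ` Y) \<subseteq> closure B" "|B| <o \<kappa>"
    by (rule dense_subset_of_small_cardinality[OF \<kappa> A(3)])
  have "\<forall>z. \<exists>u. (\<lambda>n::nat. \<iota> (u n)) \<longlonglongrightarrow> z"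
    using closure_image_sequence[of _ \<iota> UNIV] dense by (metis UNIV_I)
  from choice[OF this] obtain a where a: "\<And>z. (\<lambda>n::nat. \<iota> (a z n)) \<longlonglongrightarrow> z" by blast
  have "\<forall>z. \<exists>u. z \<in> B \<longrightarrow> (\<forall>n. u n \<in> Y) \<and> (\<lambda>n::nat. \<iota> (u n)) \<longlonglongrightarrow> z"
    using closure_image_sequence[of _ \<iota> Y] B(1) by (metis IntD2 subsetD)
  from choice[OF this] obtain b where
    b: "\<And>z n. z \<in> B \<Longrightarrow> b z n \<in> Y" "\<And>z. z \<in> B \<Longrightarrow> (\<lambda>n::nat. \<iota> (b z n)) \<longlonglongrightarrow> z" by blast
  \<comment> \<open>The sequences \<open>b\<close> stay in \<open>Y\<close>, where \<open>T\<close> is the identity; this makes the extension fix \<open>B\<close>.\<close>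
  define D where "D = (\<lambda>(z, n). a z n) ` (A \<times> UNIV) \<union> (\<lambda>(z, n). b z n) ` (B \<times> UNIV)"
  have "|D| <o \<kappa>"
    unfolding D_def by (intro ordLess_Un ordLess_image_times_nat \<kappa> A B)
  then obtain T where T: "linear T" "range T \<subseteq> Y" "\<And>d. d \<in> rat_span D \<Longrightarrow> d \<in> Y \<Longrightarrow> T d = d"
    and T_le: "\<And>d. d \<in> rat_span D \<Longrightarrow> norm (\<iota> (T d)) \<le> norm (\<iota> d)"
    using T[OF ordLess_rat_span[OF \<kappa>]] by blast
  define \<tau> where "\<tau> = (\<lambda>s. \<iota> (T s))"
  have \<tau>: "linear \<tau>" unfolding \<tau>_def using linear_compose[OF T(1) \<iota>] by (simp add: o_def)
  have \<tau>_le: "norm (\<tau> s) \<le> norm (\<iota> s)" if s: "s \<in> span D" for s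
  proof (rule field_le_epsilon)
    fix e :: real
    assume "0 < e"
    \<comment> \<open>The summand \<open>norm (\<tau> s)\<close> is needed since no bound for \<open>\<tau>\<close> on the span is known beforehand.\<close>
    have "seminorm (\<lambda>s. norm (\<iota> s) + norm (\<tau> s))"
    proof
      show "norm (\<iota> (u + v)) + norm (\<tau> (u + v)) \<le> norm (\<iota> u) + norm (\<tau> u) + (norm (\<iota> v) + norm (\<tau> v))" for u v
        using norm_triangle_ineq[of "\<iota> u" "\<iota> v"] norm_triangle_ineq[of "\<tau> u" "\<tau> v"]
        by (simp add: linear_add \<iota> \<tau>)
      show "norm (\<iota> (c *\<^sub>R u)) + norm (\<tau> (c *\<^sub>R u)) = \<bar>c\<bar> * (norm (\<iota> u) + norm (\<tau> u))" for c u
        by (simp add: linear_scale \<iota> \<tau> algebra_simps)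
    qed
    then obtain d where d: "d \<in> rat_span D" "norm (\<iota> (s - d)) + norm (\<tau> (s - d)) < e"
      using s \<open>0 < e\<close> by (rule rat_span_approx)
    have "norm (\<tau> s) \<le> norm (\<tau> d) + norm (\<tau> (s - d))"
      using norm_triangle_ineq[of "\<tau> d" "\<tau> (s - d)"] by (simp add: linear_diff \<tau>)
    moreover have "norm (\<tau> d) \<le> norm (\<iota> d)" using T_le[OF d(1)] by (simp add: \<tau>_def)
    moreover have "norm (\<iota> d) \<le> norm (\<iota> s) + norm (\<iota> (s - d))"
      using norm_triangle_ineq[of "\<iota> s" "- \<iota> (s - d)"] by (simp add: linear_diff \<iota> norm_minus_commute)
    ultimately show "norm (\<tau> s) \<le> norm (\<iota> s) + e" using d(2) by simp
  qed
  define H where "H = closure (\<iota> ` span D)"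
  obtain P where P: "linear_between H (closure (\<tau> ` span D)) P"
    and P_le: "\<And>z. z \<in> H \<Longrightarrow> norm (P z) \<le> norm z"
    and P_lim: "\<And>u z. (\<And>n::nat. u n \<in> span D) \<Longrightarrow> (\<lambda>n. \<iota> (u n)) \<longlonglongrightarrow> z \<Longrightarrow> (\<lambda>n. \<tau> (u n)) \<longlonglongrightarrow> P z"
    unfolding H_def using dominated_linear_extends_to_closure[OF \<iota> \<tau> subspace_span \<tau>_le] by metis
  have subH: "subspace H"
    unfolding H_def by (intro subspace_closure linear_subspace_image \<iota> subspace_span)
  have aD: "a z n \<in> span D" if "z \<in> A" for z n
    using that by (intro span_base) (auto simp: D_def)
  have bD: "b z n \<in> D" if "z \<in> B" for z n
    using that by (auto simp: D_def)
  have "z \<in> H" if "z \<in> A" for z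
    unfolding H_def closure_sequential
    using a aD[OF that] by (intro exI[of _ "\<lambda>n. \<iota> (a z n)"]) auto
  then have "A \<subseteq> H" by blast
  then have "span A \<subseteq> H" using subH by (rule span_minimal)
  then have "closure (span A) \<subseteq> H" unfolding H_def by (simp add: closure_minimal)
  then have "G \<subseteq> H" using A(2) by blast
  have P_fix_B: "P z = z" if z: "z \<in> B" for z
  proof -
    have "(\<lambda>n. \<tau> (b z n)) \<longlonglongrightarrow> P z"
      using b(2)[OF z] by (rule P_lim[rotated]) (use bD[OF z] span_base in blast)
    moreover have "\<tau> (b z n) = \<iota> (b z n)" for n
      unfolding \<tau>_def using T(3) bD[OF z] b(1)[OF z] rat_span_superset by (metis subsetD)
    ultimately show ?thesis using b(2)[OF z] LIMSEQ_unique by simp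
  qed
  have P_fix: "P z = z" if z: "z \<in> G \<inter> closure (\<iota> ` Y)" for z
  proof -
    have "norm (P z - z) \<le> 0 + e" if "0 < e" for e
    proof -
      have "0 < e / 2" using \<open>0 < e\<close> by simp
      then obtain w where w: "w \<in> B" "dist w z < e / 2"
        using subsetD[OF B(2) z] unfolding closure_approachable by blast
      have "w \<in> H" "z \<in> H" using w(1) B(1) z \<open>G \<subseteq> H\<close> by auto
      then have "P (z + (-1) *\<^sub>R w) = P z + (-1) *\<^sub>R P w"
        using P subspace_scale[OF subH] unfolding linear_between_def by metis
      moreover have "norm (P (z - w)) \<le> norm (z - w)"
        using P_le subspace_diff[OF subH \<open>z \<in> H\<close> \<open>w \<in> H\<close>] .
      ultimately have "norm (P z - w) \<le> norm (z - w)" using P_fix_B[OF w(1)] by simp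
      then show ?thesis
        using w(2) norm_triangle_ineq[of "P z - w" "w - z"] by (simp add: dist_norm norm_minus_commute)
    qed
    then have "norm (P z - z) \<le> 0" by (rule field_le_epsilon)
    then show ?thesis by simp
  qed
  have "\<tau> ` span D \<subseteq> \<iota> ` Y" using T(2) by (auto simp: \<tau>_def)
  then have "closure (\<tau> ` span D) \<subseteq> closure (\<iota> ` Y)" by (rule closure_mono)
  with P \<open>G \<subseteq> H\<close> have "linear_between G (closure (\<iota> ` Y)) P"
    unfolding linear_between_def by blast
  then show "\<exists>P. linear_between G (closure (\<iota> ` Y)) P \<and> (\<forall>x\<in>G. norm (P x) \<le> norm x) \<and>
      (\<forall>e\<in>G \<inter> closure (\<iota> ` Y). P e = e)"
    using P_le P_fix \<open>G \<subseteq> H\<close> by blast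
qed


section \<open>Tensor products of linear maps\<close>

text \<open>The representation is chosen, so that the definition makes sense for all \<open>f\<close> and \<open>g\<close>; the value is
  independent of the choice when both are linear (\<open>tensor_map_tensor_sum\<close>).\<close>

definition tensor_map ::
  "('a::real_vector \<Rightarrow> 'c::real_vector) \<Rightarrow> ('b::real_vector \<Rightarrow> 'd::real_vector) \<Rightarrow> ('a, 'b) tensor \<Rightarrow> ('c, 'd) tensor"
  where "tensor_map f g u = tensor_sum (map (map_prod f g) (SOME ps. tensor_sum ps = u))"

lemma tensor_map_tensor_sum:
  assumes f: "linear f" and g: "linear g"
  shows "tensor_map f g (tensor_sum ps) = tensor_sum (map (map_prod f g) ps)"
proof -
  let ?qs = "SOME qs. tensor_sum qs = tensor_sum ps"
  have "tensor_sum ?qs = tensor_sum ps" by (rule someI) (rule refl)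
  then have "form_sum (\<lambda>x y. B (f x) (g y)) ?qs = form_sum (\<lambda>x y. B (f x) (g y)) ps"
    if B: "bilinear B" for B :: "'b \<Rightarrow> 'd \<Rightarrow> real"
  proof (rule form_sum_eq_if_tensor_sum_eq)
    show "bilinear (\<lambda>x y. B (f x) (g y))"
      by (simp add: bilinear_def linear_iff linear_add[OF f] linear_add[OF g] linear_scale[OF f]
        linear_scale[OF g] bilinear_ladd[OF B] bilinear_radd[OF B] bilinear_lmul[OF B] bilinear_rmul[OF B])
  qed
  moreover have "form_sum B (map (map_prod f g) qs) = form_sum (\<lambda>x y. B (f x) (g y)) qs"
    for B :: "'b \<Rightarrow> 'd \<Rightarrow> real" and qs
    by (induction qs) auto
  ultimately have "same_tensor (map (map_prod f g) ?qs) (map (map_prod f g) ps)"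
    by (simp add: same_tensor_def)
  then show ?thesis by (simp add: tensor_map_def tensor_sum_eq_iff)
qed

lemma linear_tensor_map:
  assumes f: "linear f" and g: "linear g"
  shows "linear (tensor_map f g)"
proof (rule linearI)
  fix u v :: "('a, 'c) tensor"
  obtain ps qs where "u = tensor_sum ps" "v = tensor_sum qs" by (metis tensor_sum_exhaust)
  then show "tensor_map f g (u + v) = tensor_map f g u + tensor_map f g v"
    using tensor_map_tensor_sum[OF f g, of "ps @ qs"] by (simp add: tensor_map_tensor_sum f g)
next
  fix c and u :: "('a, 'c) tensor"
  obtain ps where u: "u = tensor_sum ps" by (rule tensor_sum_exhaust)
  have "map (map_prod f g) (map (\<lambda>(x, y). (c *\<^sub>R x, y)) ps) =
      map (\<lambda>(x, y). (c *\<^sub>R x, y)) (map (map_prod f g) ps)"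
    by (auto simp: linear_scale f)
  then show "tensor_map f g (c *\<^sub>R u) = c *\<^sub>R tensor_map f g u"
    by (simp only: u tensor_sum_scale tensor_map_tensor_sum f g)
qed

lemma alg_tensor_iff:
  assumes E: "subspace E"
  shows "u \<in> alg_tensor E F \<longleftrightarrow> (\<exists>ps. set ps \<subseteq> E \<times> F \<and> tensor_sum ps = u)"
proof
  assume "u \<in> alg_tensor E F"
  then show "\<exists>ps. set ps \<subseteq> E \<times> F \<and> tensor_sum ps = u"
    unfolding alg_tensor_def
  proof (induction rule: span_induct_alt)
    case base
    show ?case by (intro exI[of _ "[]"]) simp
  next
    case (step c v w)
    then obtain x y ps where v: "v = elem_tensor x y" "x \<in> E" "y \<in> F"
      and ps: "set ps \<subseteq> E \<times> F" "tensor_sum ps = w" by blast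
    have "c *\<^sub>R v = elem_tensor (c *\<^sub>R x) y"
      using tensor_sum_scale[of c "[(x, y)]"] v by simp
    then show ?case
      using v ps by (intro exI[of _ "(c *\<^sub>R x, y) # ps"]) (simp add: subspace_scale E)
  qed
next
  assume "\<exists>ps. set ps \<subseteq> E \<times> F \<and> tensor_sum ps = u"
  then obtain ps where ps: "set ps \<subseteq> E \<times> F" and u: "tensor_sum ps = u" by blast
  from ps have "tensor_sum ps \<in> alg_tensor E F"
  proof (induction ps)
    case (Cons p ps)
    then have "fst p \<in> E" "snd p \<in> F" by auto
    then have "elem_tensor (fst p) (snd p) \<in> alg_tensor E F"
      unfolding alg_tensor_def by (intro span_base) blast
    with Cons show ?case by (simp add: alg_tensor_def span_add)
  qed (simp add: alg_tensor_def span_zero)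
  then show "u \<in> alg_tensor E F" by (simp add: u)
qed

lemma range_tensor_map:
  assumes "linear f" "linear g" "subspace E" "range f \<subseteq> E" "range g \<subseteq> F"
  shows "range (tensor_map f g) \<subseteq> alg_tensor E F"
proof clarify
  fix u :: "('a, 'c) tensor"
  obtain ps where u: "u = tensor_sum ps" by (rule tensor_sum_exhaust)
  have "set (map (map_prod f g) ps) \<subseteq> E \<times> F" using assms(4,5) by (auto simp: image_subset_iff)
  then show "tensor_map f g u \<in> alg_tensor E F"
    unfolding alg_tensor_iff[OF assms(3)] u tensor_map_tensor_sum[OF assms(1,2)] by blast
qed

lemma map_prod_fixes_list:
  assumes "\<And>x. x \<in> S \<inter> E \<Longrightarrow> f x = x" "\<And>y. y \<in> T \<inter> F \<Longrightarrow> g y = y"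
    and "set ps \<subseteq> S \<times> T" "set ps \<subseteq> E \<times> F"
  shows "map (map_prod f g) ps = ps"
proof (rule map_idI)
  fix p assume "p \<in> set ps"
  then have "fst p \<in> S \<inter> E" "snd p \<in> T \<inter> F" using assms(3,4) by (auto simp: mem_Times_iff)
  then show "map_prod f g p = p" by (simp add: assms(1,2) prod_eq_iff)
qed


section \<open>Contractions provided by the ideal property\<close>

text \<open>Composing the operator on \<open>span A\<close> with an algebraic projection onto \<open>span A\<close> makes it defined on
  the whole space with range still in \<open>E\<close>; norm estimates hold on \<open>span A\<close> only.\<close>

lemma kappa_ideal_contraction:
  assumes \<kappa>: "Card_order \<kappa>" and E: "kappa_ideal \<kappa> E" and A: "|A| <o \<kappa>"
  obtains f where "linear f" "range f \<subseteq> E" "\<And>x. x \<in> span A \<Longrightarrow> norm (f x) \<le> norm x"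
    "\<And>x. x \<in> span A \<inter> E \<Longrightarrow> f x = x"
proof -
  have "A \<subseteq> span A" "span A \<subseteq> closure (span A)" by (auto intro: span_base closure_subset[THEN subsetD])
  then have "dens (span A) <o \<kappa>" using A by (auto simp: dens_less_iff[OF \<kappa>])
  then obtain P where P: "linear_between (span A) E P" "\<forall>x\<in>span A. norm (P x) \<le> norm x"
      "\<forall>x\<in>span A \<inter> E. P x = x"
    using E subspace_span[of A] unfolding kappa_ideal_def by blast
  \<comment> \<open>A linear, in general discontinuous, projection onto \<open>span A\<close>.\<close>
  obtain r where r: "range r \<subseteq> span A" "linear r" "\<And>x. x \<in> span A \<Longrightarrow> r x = x"
    using linear_exists_left_inverse_on[of id "span A"] by (auto simp: linear_id)
  have rA: "r x \<in> span A" for x using r(1) by blast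
  have "linear (\<lambda>x. P (r x))"
    using P(1) rA by (intro linearI) (auto simp: linear_between_def linear_add linear_scale r(2))
  moreover have "range (\<lambda>x. P (r x)) \<subseteq> E" using P(1) rA by (auto simp: linear_between_def)
  ultimately show thesis using P(2,3) r(3) by (intro that[of "\<lambda>x. P (r x)"]) auto
qed

text \<open>\<open>S\<close> and \<open>T\<close> are spanned by the left and the right entries of the representations in \<open>L\<close>.\<close>

lemma kappa_ideal_contraction_pair:
  fixes E :: "'a::banach set" and F :: "'b::banach set"
  assumes \<kappa>: "Card_order \<kappa>" "natLeq <o \<kappa>" and E: "kappa_ideal \<kappa> E" and F: "kappa_ideal \<kappa> F"
    and L: "|L :: ('a \<times> 'b) list set| <o \<kappa>"
  obtains f g S T where "linear f" "linear g" "range f \<subseteq> E" "range g \<subseteq> F"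
    "subspace S" "subspace T" "\<And>ps. ps \<in> L \<Longrightarrow> set ps \<subseteq> S \<times> T"
    "\<And>x. x \<in> S \<Longrightarrow> norm (f x) \<le> norm x" "\<And>y. y \<in> T \<Longrightarrow> norm (g y) \<le> norm y"
    "\<And>x. x \<in> S \<inter> E \<Longrightarrow> f x = x" "\<And>y. y \<in> T \<inter> F \<Longrightarrow> g y = y"
proof -
  \<comment> \<open>Indices beyond the end of a list contribute arbitrary vectors, which do no harm.\<close>
  define A where "A = (\<lambda>(ps, i). fst (ps ! i)) ` (L \<times> UNIV)"
  define B where "B = (\<lambda>(ps, i). snd (ps ! i)) ` (L \<times> UNIV)"
  have "|A| <o \<kappa>" "|B| <o \<kappa>"
    unfolding A_def B_def by (intro ordLess_image_times_nat \<kappa> L)+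
  obtain f where f: "linear f" "range f \<subseteq> E" "\<And>x. x \<in> span A \<Longrightarrow> norm (f x) \<le> norm x"
    "\<And>x. x \<in> span A \<inter> E \<Longrightarrow> f x = x"
    using kappa_ideal_contraction[OF \<kappa>(1) E \<open>|A| <o \<kappa>\<close>] by metis
  obtain g where g: "linear g" "range g \<subseteq> F" "\<And>y. y \<in> span B \<Longrightarrow> norm (g y) \<le> norm y"
    "\<And>y. y \<in> span B \<inter> F \<Longrightarrow> g y = y"
    using kappa_ideal_contraction[OF \<kappa>(1) F \<open>|B| <o \<kappa>\<close>] by metis
  have "set ps \<subseteq> span A \<times> span B" if ps: "ps \<in> L" for ps
  proof
    fix p assume "p \<in> set ps"
    then obtain i where "p = ps ! i" by (auto simp: in_set_conv_nth)
    then have "fst p \<in> A" "snd p \<in> B" using ps by (force simp: A_def B_def)+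
    then show "p \<in> span A \<times> span B" by (auto simp: mem_Times_iff intro: span_base)
  qed
  then show thesis
    using that[of f g "span A" "span B"] f g subspace_span by blast
qed

text \<open>When \<open>\<iota>\<close> is isometric for \<open>p\<close>, convergence of the images makes the preimages \<open>p\<close>-Cauchy.\<close>

lemma completion_range_eq_closure:
  fixes \<iota> :: "'s::real_vector \<Rightarrow> 'z::real_normed_vector"
  assumes \<iota>: "linear \<iota>" and S: "subspace S" and norm: "\<And>u. u \<in> S \<Longrightarrow> norm (\<iota> u) = p u"
  shows "completion_range p S \<iota> = closure (\<iota> ` S)"
proof (intro equalityI subsetI)
  fix z assume "z \<in> completion_range p S \<iota>"
  then obtain u where "range u \<subseteq> S" "(\<lambda>n. \<iota> (u n)) \<longlonglongrightarrow> z" by (auto simp: completion_range_def)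
  then show "z \<in> closure (\<iota> ` S)"
    unfolding closure_sequential by (intro exI[of _ "\<lambda>n. \<iota> (u n)"]) auto
next
  fix z assume "z \<in> closure (\<iota> ` S)"
  then obtain u where u: "\<And>n::nat. u n \<in> S" "(\<lambda>n. \<iota> (u n)) \<longlonglongrightarrow> z" by (metis closure_image_sequence)
  have "p (u m - u n) = norm (\<iota> (u m) - \<iota> (u n))" for m n
    using norm[OF subspace_diff[OF S u(1) u(1)]] by (simp add: linear_diff \<iota>)
  then have "cauchy_wrt p u"
    using LIMSEQ_imp_Cauchy[OF u(2)] by (simp add: cauchy_wrt_def Cauchy_iff)
  then show "z \<in> completion_range p S \<iota>" using u by (auto simp: completion_range_def)
qed

lemma subspace_alg_tensor: "subspace (alg_tensor E F)"
  unfolding alg_tensor_def by (rule subspace_span)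


section \<open>The projective tensor product\<close>

lemma cost_contraction_le:
  assumes "\<And>x. x \<in> S \<Longrightarrow> norm (f x) \<le> norm x" "\<And>y. y \<in> T \<Longrightarrow> norm (g y) \<le> norm y"
    and "set ps \<subseteq> S \<times> T"
  shows "(\<Sum>(x, y)\<leftarrow>map (map_prod f g) ps. norm x * norm y) \<le> (\<Sum>(x, y)\<leftarrow>ps. norm x * norm y)"
  using assms(3) by (induction ps) (auto intro!: add_mono mult_mono assms(1,2))

lemma proj_norm_le_cost:
  assumes "set ps \<subseteq> E \<times> F"
  shows "proj_norm E F (tensor_sum ps) \<le> (\<Sum>(x, y)\<leftarrow>ps. norm x * norm y)"
  unfolding proj_norm_def
  by (rule cInf_lower) (use assms in \<open>auto intro!: bdd_belowI[of _ 0] norm_sum_nonneg\<close>)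

text \<open>Any representation of \<open>u\<close> in the whole space is moved into \<open>E \<times> F\<close> at no cost by contractions
  chosen for it. They do not change \<open>u\<close>, because they fix the entries of some representation \<open>qs\<close> in
  \<open>E \<times> F\<close>.\<close>

lemma proj_norm_kappa_ideal:
  fixes E :: "'a::banach set" and F :: "'b::banach set"
  assumes \<kappa>: "Card_order \<kappa>" "natLeq <o \<kappa>" and E: "kappa_ideal \<kappa> E" and F: "kappa_ideal \<kappa> F"
    and u: "u \<in> alg_tensor E F"
  shows "proj_norm E F u = proj_norm UNIV UNIV u"
proof (rule antisym)
  have "subspace E" using E by (simp add: kappa_ideal_def)
  then obtain qs where qs: "set qs \<subseteq> E \<times> F" "tensor_sum qs = u" using u by (auto simp: alg_tensor_iff)
  show "proj_norm E F u \<le> proj_norm UNIV UNIV u"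
  proof (rule proj_norm_greatest)
    fix ps :: "('a \<times> 'b) list"
    assume ps: "tensor_sum ps = u"
    have "|{ps, qs}| <o \<kappa>" by (intro ordLess_finite \<kappa>) simp
    then obtain f g S T where fg: "linear f" "linear g" "range f \<subseteq> E" "range g \<subseteq> F"
      and sub: "\<And>rs. rs \<in> {ps, qs} \<Longrightarrow> set rs \<subseteq> S \<times> T"
      and le: "\<And>x. x \<in> S \<Longrightarrow> norm (f x) \<le> norm x" "\<And>y. y \<in> T \<Longrightarrow> norm (g y) \<le> norm y"
      and fixed: "\<And>x. x \<in> S \<inter> E \<Longrightarrow> f x = x" "\<And>y. y \<in> T \<inter> F \<Longrightarrow> g y = y"
      using kappa_ideal_contraction_pair[OF \<kappa> E F] by metis
    have "tensor_map f g u = u"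
      using map_prod_fixes_list[OF fixed sub qs(1)] tensor_map_tensor_sum[OF fg(1,2), of qs] qs by simp
    then have "tensor_sum (map (map_prod f g) ps) = u"
      using tensor_map_tensor_sum[OF fg(1,2), of ps] ps by simp
    moreover have "set (map (map_prod f g) ps) \<subseteq> E \<times> F" using fg by auto
    ultimately have "proj_norm E F u \<le> (\<Sum>(x, y)\<leftarrow>map (map_prod f g) ps. norm x * norm y)"
      using proj_norm_le_cost by blast
    also have "\<dots> \<le> (\<Sum>(x, y)\<leftarrow>ps. norm x * norm y)"
      using cost_contraction_le[OF le] sub by blast
    finally show "proj_norm E F u \<le> (\<Sum>(x, y)\<leftarrow>ps. norm x * norm y)" .
  qed
  show "proj_norm UNIV UNIV u \<le> proj_norm E F u"
    unfolding proj_norm_def[of E F]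
  proof (rule cInf_greatest)
    fix r assume "r \<in> {(\<Sum>(x, y)\<leftarrow>ps. norm x * norm y) |ps. set ps \<subseteq> E \<times> F \<and> tensor_sum ps = u}"
    then show "proj_norm UNIV UNIV u \<le> r" using proj_norm_le by blast
  qed (use qs in blast)
qed

lemma linear_proj_embed: "linear proj_embed"
  by (rule linearI) (rule proj_embed_add proj_embed_scaleR)+

lemma closure_range_proj_embed: "closure (range proj_embed) = UNIV"
proof -
  have "z \<in> closure (range proj_embed)" for z :: "('a, 'b) proj_tensor"
    using proj_tensor_approx[of z] unfolding closure_sequential by (metis rangeI)
  then show ?thesis by blast
qed

lemma proj_norm_near_representation:
  assumes "0 < e"
  obtains ps where "tensor_sum ps = u" "(\<Sum>(x, y)\<leftarrow>ps. norm x * norm y) < proj_norm UNIV UNIV u + e"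
  using proj_norm_greatest[of u "proj_norm UNIV UNIV u + e"] assms that by (meson leI not_le less_add_same_cancel1)

theorem kappa_ideal_proj_tensor_of:
  fixes E :: "'a::banach set" and F :: "'b::banach set"
  assumes \<kappa>: "Card_order \<kappa>" "natLeq <o \<kappa>" and E: "kappa_ideal \<kappa> E" and F: "kappa_ideal \<kappa> F"
  shows "kappa_ideal \<kappa> (proj_tensor_of E F)"
proof -
  have subE: "subspace E" using E by (simp add: kappa_ideal_def)
  have "\<exists>T. linear T \<and> range T \<subseteq> alg_tensor E F \<and> (\<forall>d\<in>D \<inter> alg_tensor E F. T d = d) \<and>
      (\<forall>d\<in>D. norm (proj_embed (T d)) \<le> norm (proj_embed d))"
    if D: "|D| <o \<kappa>" for D
  proof -
    have "\<forall>d. \<exists>qs. d \<in> alg_tensor E F \<longrightarrow> set qs \<subseteq> E \<times> F \<and> tensor_sum qs = d"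
      using alg_tensor_iff[OF subE] by blast
    from choice[OF this] obtain t where
      t: "\<And>d. d \<in> alg_tensor E F \<Longrightarrow> set (t d) \<subseteq> E \<times> F \<and> tensor_sum (t d) = d" by blast
    have "\<exists>ps. tensor_sum ps = d \<and>
        (\<Sum>(x, y)\<leftarrow>ps. norm x * norm y) < proj_norm UNIV UNIV d + inverse (Suc n)" for d :: "('a, 'b) tensor" and n
      by (rule proj_norm_near_representation[of "inverse (Suc n)" d]) auto
    then obtain s where s: "\<And>d n. tensor_sum (s d n) = (d :: ('a, 'b) tensor)"
      "\<And>d n. (\<Sum>(x, y)\<leftarrow>s d n. norm x * norm y) < proj_norm UNIV UNIV d + inverse (Suc n)"
      by metis
    \<comment> \<open>The lists \<open>s d n\<close> carry the norm estimate, the lists \<open>t d\<close> the identity on \<open>alg_tensor E F\<close>.\<close>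
    define L where "L = (\<lambda>(d, n). s d n) ` (D \<times> UNIV) \<union> t ` D"
    have "|L| <o \<kappa>"
      unfolding L_def using D card_of_image ordLeq_ordLess_trans
      by (intro ordLess_Un ordLess_image_times_nat \<kappa> D) blast
    then obtain f g S T where fg: "linear f" "linear g" "range f \<subseteq> E" "range g \<subseteq> F"
      and sub: "\<And>ps. ps \<in> L \<Longrightarrow> set ps \<subseteq> S \<times> T"
      and le: "\<And>x. x \<in> S \<Longrightarrow> norm (f x) \<le> norm x" "\<And>y. y \<in> T \<Longrightarrow> norm (g y) \<le> norm y"
      and fixed: "\<And>x. x \<in> S \<inter> E \<Longrightarrow> f x = x" "\<And>y. y \<in> T \<inter> F \<Longrightarrow> g y = y"
      using kappa_ideal_contraction_pair[OF \<kappa> E F] by metis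
    have "tensor_map f g d = d" if d: "d \<in> D \<inter> alg_tensor E F" for d
    proof -
      have "t d \<in> L" using d by (auto simp: L_def)
      then have "map (map_prod f g) (t d) = t d"
        by (intro map_prod_fixes_list[OF fixed sub]) (use t d in auto)
      then show ?thesis using tensor_map_tensor_sum[OF fg(1,2), of "t d"] t d by simp
    qed
    moreover have "norm (proj_embed (tensor_map f g d)) \<le> norm (proj_embed d)" if d: "d \<in> D" for d
    proof -
      have "proj_norm UNIV UNIV (tensor_map f g d) \<le> proj_norm UNIV UNIV d + inverse (Suc n)" for n
      proof -
        have "s d n \<in> L" using d by (auto simp: L_def)
        have "proj_norm UNIV UNIV (tensor_map f g d) \<le>
            (\<Sum>(x, y)\<leftarrow>map (map_prod f g) (s d n). norm x * norm y)"
          using proj_norm_le[of "map (map_prod f g) (s d n)"] tensor_map_tensor_sum[OF fg(1,2), of "s d n"] s(1)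
          by simp
        also have "\<dots> \<le> (\<Sum>(x, y)\<leftarrow>s d n. norm x * norm y)"
          using cost_contraction_le[OF le] sub[OF \<open>s d n \<in> L\<close>] by blast
        finally show ?thesis using s(2)[of d n] by simp
      qed
      then have "proj_norm UNIV UNIV (tensor_map f g d) \<le> proj_norm UNIV UNIV d + 0"
        by (intro LIMSEQ_le_const[OF tendsto_add[OF tendsto_const LIMSEQ_inverse_real_of_nat]]) auto
      then show ?thesis by (simp add: norm_proj_embed)
    qed
    ultimately show ?thesis
      using linear_tensor_map[OF fg(1,2)] range_tensor_map[OF fg(1,2) subE fg(3,4)] by blast
  qed
  then have "kappa_ideal \<kappa> (closure (proj_embed ` alg_tensor E F))"
    by (rule kappa_ideal_closureI[OF \<kappa> linear_proj_embed closure_range_proj_embed subspace_alg_tensor])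
  moreover have "proj_tensor_of E F = closure (proj_embed ` alg_tensor E F)"
    unfolding proj_tensor_of_def
    by (rule completion_range_eq_closure[OF linear_proj_embed subspace_alg_tensor])
      (simp add: norm_proj_embed proj_norm_kappa_ideal[OF assms])
  ultimately show ?thesis by simp
qed


section \<open>The injective tensor product\<close>

text \<open>By the Hahn-Banach theorem both suprema range over the same set of numbers.\<close>

lemma inj_norm_subspaces:
  assumes E: "subspace E" and F: "subspace F" and u: "u \<in> alg_tensor E F"
  shows "inj_norm E F u = inj_norm UNIV UNIV u"
proof -
  obtain rs where rs: "set rs \<subseteq> E \<times> F" "tensor_sum rs = u" using E u by (auto simp: alg_tensor_iff)
  have "{\<bar>\<Sum>(x, y)\<leftarrow>ps. \<phi> x * \<psi> y\<bar> |\<phi> \<psi> ps.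
      \<phi> \<in> dual_ball E \<and> \<psi> \<in> dual_ball F \<and> set ps \<subseteq> E \<times> F \<and> tensor_sum ps = u} =
    {\<bar>\<Sum>(x, y)\<leftarrow>ps. \<phi> x * \<psi> y\<bar> |\<phi> \<psi> ps.
      \<phi> \<in> dual_ball UNIV \<and> \<psi> \<in> dual_ball UNIV \<and> set ps \<subseteq> UNIV \<times> UNIV \<and> tensor_sum ps = u}"
    (is "?L = ?R")
  proof (intro equalityI subsetI)
    fix r assume "r \<in> ?L"
    then obtain \<phi> \<psi> ps where r: "r = \<bar>\<Sum>(x, y)\<leftarrow>ps. \<phi> x * \<psi> y\<bar>" "\<phi> \<in> dual_ball E" "\<psi> \<in> dual_ball F"
      "set ps \<subseteq> E \<times> F" "tensor_sum ps = u" by blast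
    obtain \<Phi> where \<Phi>: "\<Phi> \<in> dual_ball UNIV" "\<And>x. x \<in> E \<Longrightarrow> \<Phi> x = \<phi> x"
      using dual_ball_extension[OF E r(2)] by metis
    obtain \<Psi> where \<Psi>: "\<Psi> \<in> dual_ball UNIV" "\<And>x. x \<in> F \<Longrightarrow> \<Psi> x = \<psi> x"
      using dual_ball_extension[OF F r(3)] by metis
    have "(\<Sum>(x, y)\<leftarrow>ps. \<phi> x * \<psi> y) = (\<Sum>(x, y)\<leftarrow>ps. \<Phi> x * \<Psi> y)"
      using r(4) by (induction ps) (auto simp: \<Phi> \<Psi>)
    then show "r \<in> ?R" using r \<Phi>(1) \<Psi>(1) by auto
  next
    fix r assume "r \<in> ?R"
    then obtain \<phi> \<psi> ps where r: "r = \<bar>\<Sum>(x, y)\<leftarrow>ps. \<phi> x * \<psi> y\<bar>" "\<phi> \<in> dual_ball UNIV" "\<psi> \<in> dual_ball UNIV"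
      "tensor_sum ps = u" by blast
    then have "r = \<bar>\<Sum>(x, y)\<leftarrow>rs. \<phi> x * \<psi> y\<bar>"
      using dual_pair_well_defined[of UNIV UNIV \<phi> \<psi> ps rs] rs(2) by simp
    moreover have "\<phi> \<in> dual_ball E" "\<psi> \<in> dual_ball F"
      using r(2,3) by (auto simp: dual_ball_def linear_between_def)
    ultimately show "r \<in> ?L" using rs by blast
  qed
  then show ?thesis by (simp only: inj_norm_def)
qed

text \<open>A pair of functionals \<open>\<phi>, \<psi>\<close> tested on the image is the pair \<open>\<phi> \<circ> f, \<psi> \<circ> g\<close> tested on \<open>ps\<close>. These
  are bounded by one on \<open>S\<close> and \<open>T\<close> only, so they are replaced by extensions from there.\<close>

lemma inj_norm_contraction_le:
  assumes f: "linear f" and g: "linear g" and S: "subspace S" and T: "subspace T"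
    and le: "\<And>x. x \<in> S \<Longrightarrow> norm (f x) \<le> norm x" "\<And>y. y \<in> T \<Longrightarrow> norm (g y) \<le> norm y"
    and ps: "set ps \<subseteq> S \<times> T"
  shows "inj_norm UNIV UNIV (tensor_sum (map (map_prod f g) ps)) \<le> inj_norm UNIV UNIV (tensor_sum ps)"
proof (rule inj_norm_least)
  fix \<phi> :: "'b \<Rightarrow> real" and \<psi> :: "'d \<Rightarrow> real"
  assume \<phi>: "\<phi> \<in> dual_ball UNIV" and \<psi>: "\<psi> \<in> dual_ball UNIV"
  have "(\<lambda>x. \<phi> (f x)) \<in> dual_ball S"
    using \<phi> le(1) order_trans
    by (fastforce simp: dual_ball_def linear_between_def linear_add linear_scale f)
  then obtain \<Phi> where \<Phi>: "\<Phi> \<in> dual_ball UNIV" "\<And>x. x \<in> S \<Longrightarrow> \<Phi> x = \<phi> (f x)"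
    using dual_ball_extension[OF S] by metis
  have "(\<lambda>x. \<psi> (g x)) \<in> dual_ball T"
    using \<psi> le(2) order_trans
    by (fastforce simp: dual_ball_def linear_between_def linear_add linear_scale g)
  then obtain \<Psi> where \<Psi>: "\<Psi> \<in> dual_ball UNIV" "\<And>y. y \<in> T \<Longrightarrow> \<Psi> y = \<psi> (g y)"
    using dual_ball_extension[OF T] by metis
  have "(\<Sum>(x, y)\<leftarrow>map (map_prod f g) ps. \<phi> x * \<psi> y) = (\<Sum>(x, y)\<leftarrow>ps. \<Phi> x * \<Psi> y)"
    using ps by (induction ps) (auto simp: \<Phi> \<Psi>)
  then show "\<bar>\<Sum>(x, y)\<leftarrow>map (map_prod f g) ps. \<phi> x * \<psi> y\<bar> \<le> inj_norm UNIV UNIV (tensor_sum ps)"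
    using inj_norm_ge[OF \<Phi>(1) \<Psi>(1), of ps] by simp
qed

lemma linear_inj_embed: "linear inj_embed"
  by (rule linearI) (rule inj_embed_add inj_embed_scaleR)+

lemma closure_range_inj_embed: "closure (range inj_embed) = UNIV"
proof -
  have "z \<in> closure (range inj_embed)" for z :: "('a, 'b) inj_tensor"
    using inj_tensor_approx[of z] unfolding closure_sequential by (metis rangeI)
  then show ?thesis by blast
qed

theorem kappa_ideal_inj_tensor_of:
  fixes E :: "'a::banach set" and F :: "'b::banach set"
  assumes \<kappa>: "Card_order \<kappa>" "natLeq <o \<kappa>" and E: "kappa_ideal \<kappa> E" and F: "kappa_ideal \<kappa> F"
  shows "kappa_ideal \<kappa> (inj_tensor_of E F)"
proof -
  have subE: "subspace E" and subF: "subspace F" using E F by (auto simp: kappa_ideal_def)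
  have "\<exists>T. linear T \<and> range T \<subseteq> alg_tensor E F \<and> (\<forall>d\<in>D \<inter> alg_tensor E F. T d = d) \<and>
      (\<forall>d\<in>D. norm (inj_embed (T d)) \<le> norm (inj_embed d))"
    if D: "|D| <o \<kappa>" for D
  proof -
    have "\<forall>d. \<exists>ps. tensor_sum ps = d \<and> (d \<in> alg_tensor E F \<longrightarrow> set ps \<subseteq> E \<times> F)"
      using alg_tensor_iff[OF subE] tensor_sum_exhaust by metis
    from choice[OF this] obtain t where
      t: "\<And>d. tensor_sum (t d) = d" "\<And>d. d \<in> alg_tensor E F \<Longrightarrow> set (t d) \<subseteq> E \<times> F" by blast
    have "|t ` D| <o \<kappa>" using D card_of_image ordLeq_ordLess_trans by blast
    then obtain f g S T where fg: "linear f" "linear g" "range f \<subseteq> E" "range g \<subseteq> F"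
      and ST: "subspace S" "subspace T" and sub: "\<And>ps. ps \<in> t ` D \<Longrightarrow> set ps \<subseteq> S \<times> T"
      and le: "\<And>x. x \<in> S \<Longrightarrow> norm (f x) \<le> norm x" "\<And>y. y \<in> T \<Longrightarrow> norm (g y) \<le> norm y"
      and fixed: "\<And>x. x \<in> S \<inter> E \<Longrightarrow> f x = x" "\<And>y. y \<in> T \<inter> F \<Longrightarrow> g y = y"
      using kappa_ideal_contraction_pair[OF \<kappa> E F] by metis
    have map_t: "tensor_map f g d = tensor_sum (map (map_prod f g) (t d))" for d
      using tensor_map_tensor_sum[OF fg(1,2), of "t d"] t(1) by simp
    have "tensor_map f g d = d" if d: "d \<in> D \<inter> alg_tensor E F" for d
    proof -
      have "map (map_prod f g) (t d) = t d"
        by (intro map_prod_fixes_list[OF fixed sub]) (use t d in auto)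
      then show ?thesis by (simp add: map_t t(1))
    qed
    moreover have "norm (inj_embed (tensor_map f g d)) \<le> norm (inj_embed d)" if d: "d \<in> D" for d
      using inj_norm_contraction_le[OF fg(1,2) ST le sub, of "t d"] d
      by (simp add: norm_inj_embed map_t t(1))
    ultimately show ?thesis
      using linear_tensor_map[OF fg(1,2)] range_tensor_map[OF fg(1,2) subE fg(3,4)] by blast
  qed
  then have "kappa_ideal \<kappa> (closure (inj_embed ` alg_tensor E F))"
    by (rule kappa_ideal_closureI[OF \<kappa> linear_inj_embed closure_range_inj_embed subspace_alg_tensor])
  moreover have "inj_tensor_of E F = closure (inj_embed ` alg_tensor E F)"
    unfolding inj_tensor_of_def
    by (rule completion_range_eq_closure[OF linear_inj_embed subspace_alg_tensor])
      (simp add: norm_inj_embed inj_norm_subspaces[OF subE subF])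
  ultimately show ?thesis by simp
qed


section \<open>Tensor products of ideals of cardinal type\<close>

theorem theorem3p7:
  fixes \<kappa> :: "'k rel" and E :: "'a::banach set" and F :: "'b::banach set"
  assumes "Card_order \<kappa>" and "natLeq <o \<kappa>"
    and "kappa_ideal \<kappa> E" and "kappa_ideal \<kappa> F"
  shows "kappa_ideal \<kappa> (proj_tensor_of E F) \<and> kappa_ideal \<kappa> (inj_tensor_of E F)"
  using kappa_ideal_proj_tensor_of[OF assms] kappa_ideal_inj_tensor_of[OF assms] by blast

end
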